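(* Let $K$ be a Hilbertian field of characteristic $p\geq 5$. Then there exist infinitely many ordinary elliptic curves $E$ over $K$ with pairwise distinct $j$-invariants such that $E(K)[p]$ is trivial, and hence $E(K)[p^\infty]$ is trivial.
   Context: An elliptic curve $E$ over a field $K$ of characteristic $p$ is ordinary if $E[p]$ (the $p$-torsion points over an algebraic closure of $K$) is nontrivial. $E(K)[p]$ is the group of $K$-rational points of $E$ killed by $p$, and $E(K)[p^\infty]=\bigcup_{n\ge1}E(K)[p^n]$ is the group of $K$-rational points of $p$-power order. *)

theory Defs
  imports
    "HOL-Computational_Algebra.Computational_Algebra"
    "HOL-Algebra.Algebraic_Closure_Type"
begin

section \<open>Hilbertian fields\<close>

text \<open>
  A polynomial \<open>f\<close> in \<open>K[T][X]\<close> is represented as an element of \<open>K poly poly\<close>, the outer variable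
  being \<open>X\<close>. It is regarded over the rational function field \<open>K(T)\<close> by mapping \<^const>\<open>to_fract\<close>
  over its coefficients; every polynomial over \<open>K(T)\<close> arises in this way up to a nonzero constant
  factor. Being coprime to its \<open>X\<close>-derivative says that \<open>f\<close> is separable over \<open>K(T)\<close>. The
  specialization \<open>f(a, X)\<close> evaluates each coefficient at \<open>T = a\<close>.
\<close>

definition specialize :: "'a::field poly poly \<Rightarrow> 'a \<Rightarrow> 'a poly" where
  "specialize f a = map_poly (\<lambda>c. poly c a) f"

text \<open>
  Separability of \<open>f\<close> is demanded, as is customary in positive characteristic: without it no perfect
  field of characteristic \<open>p\<close> would be Hilbertian, because of \<open>X ^ p - T\<close>.
\<close>

definition hilbertian :: "'a::field itself \<Rightarrow> bool" where
  "hilbertian (_ :: 'a itself) \<longleftrightarrow>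
     (\<forall>f :: 'a poly poly.
        irreducible (map_poly to_fract f) \<and>
        coprime (map_poly to_fract f) (pderiv (map_poly to_fract f)) \<longrightarrow>
        infinite {a. irreducible (specialize f a)})"

section \<open>Elliptic curves in Weierstrass form\<close>

text \<open>
  \<open>Weierstrass a1 a2 a3 a4 a6\<close> is the equation \<open>y\<^sup>2 + a1 x y + a3 y = x\<^sup>3 + a2 x\<^sup>2 + a4 x + a6\<close>.
  The quantities below are the usual ones, valid in every characteristic.
\<close>

datatype 'a weierstrass = Weierstrass 'a 'a 'a 'a 'a

fun weierstrass_b2 :: "'a::field weierstrass \<Rightarrow> 'a" where
  "weierstrass_b2 (Weierstrass a1 a2 a3 a4 a6) = a1 ^ 2 + 4 * a2"

fun weierstrass_b4 :: "'a::field weierstrass \<Rightarrow> 'a" where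
  "weierstrass_b4 (Weierstrass a1 a2 a3 a4 a6) = 2 * a4 + a1 * a3"

fun weierstrass_b6 :: "'a::field weierstrass \<Rightarrow> 'a" where
  "weierstrass_b6 (Weierstrass a1 a2 a3 a4 a6) = a3 ^ 2 + 4 * a6"

fun weierstrass_b8 :: "'a::field weierstrass \<Rightarrow> 'a" where
  "weierstrass_b8 (Weierstrass a1 a2 a3 a4 a6) =
     a1 ^ 2 * a6 + 4 * a2 * a6 - a1 * a3 * a4 + a2 * a3 ^ 2 - a4 ^ 2"

definition weierstrass_c4 :: "'a::field weierstrass \<Rightarrow> 'a" where
  "weierstrass_c4 E = weierstrass_b2 E ^ 2 - 24 * weierstrass_b4 E"

definition discriminant :: "'a::field weierstrass \<Rightarrow> 'a" where
  "discriminant E =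
     - (weierstrass_b2 E ^ 2 * weierstrass_b8 E) - 8 * weierstrass_b4 E ^ 3
     - 27 * weierstrass_b6 E ^ 2 + 9 * weierstrass_b2 E * weierstrass_b4 E * weierstrass_b6 E"

definition elliptic_curve :: "'a::field weierstrass \<Rightarrow> bool" where
  "elliptic_curve E \<longleftrightarrow> discriminant E \<noteq> 0"

definition j_invariant :: "'a::field weierstrass \<Rightarrow> 'a" where
  "j_invariant E = weierstrass_c4 E ^ 3 / discriminant E"

section \<open>Rational points and the group law\<close>

datatype 'a point = Infinity | Affine 'a 'a

fun on_curve :: "'a::field weierstrass \<Rightarrow> 'a point \<Rightarrow> bool" where
  "on_curve E Infinity \<longleftrightarrow> True"
| "on_curve (Weierstrass a1 a2 a3 a4 a6) (Affine x y) \<longleftrightarrow>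
     y ^ 2 + a1 * x * y + a3 * y = x ^ 3 + a2 * x ^ 2 + a4 * x + a6"

text \<open>
  Chord and tangent law, meaningful for points of \<open>E\<close>: \<open>m\<close> is the slope of the line through the two
  points (the tangent line if they coincide), and two affine points are opposite iff
  \<open>x1 = x2\<close> and \<open>y1 + y2 + a1 x2 + a3 = 0\<close>. If \<open>x1 = x2\<close> and the points are not opposite, then they
  coincide and the denominator of the tangent slope is nonzero.
\<close>

fun point_add :: "'a::field weierstrass \<Rightarrow> 'a point \<Rightarrow> 'a point \<Rightarrow> 'a point" where
  "point_add E Infinity Q = Q"
| "point_add E P Infinity = P"
| "point_add (Weierstrass a1 a2 a3 a4 a6) (Affine x1 y1) (Affine x2 y2) =
     (if x1 = x2 \<and> y1 + y2 + a1 * x2 + a3 = 0 then Infinity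
      else
        let m = (if x1 = x2
                 then (3 * x1 ^ 2 + 2 * a2 * x1 + a4 - a1 * y1) / (2 * y1 + a1 * x1 + a3)
                 else (y2 - y1) / (x2 - x1));
            x3 = m ^ 2 + a1 * m - a2 - x1 - x2
        in Affine x3 (- (y1 + m * (x3 - x1)) - a1 * x3 - a3))"

primrec point_mult :: "'a::field weierstrass \<Rightarrow> nat \<Rightarrow> 'a point \<Rightarrow> 'a point" where
  "point_mult E 0 P = Infinity"
| "point_mult E (Suc n) P = point_add E P (point_mult E n P)"

text \<open>
  \<open>torsion E n\<close> is \<open>E(K)[n]\<close>, where \<open>K\<close> is the type over which \<open>E\<close> is given;
  \<open>power_torsion E p\<close> is the union of \<open>E(K)[p ^ n]\<close> over \<open>n \<ge> 1\<close>.
\<close>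

definition torsion :: "'a::field weierstrass \<Rightarrow> nat \<Rightarrow> 'a point set" where
  "torsion E n = {P. on_curve E P \<and> point_mult E n P = Infinity}"

definition power_torsion :: "'a::field weierstrass \<Rightarrow> nat \<Rightarrow> 'a point set" where
  "power_torsion E p = (\<Union>n\<in>{1..}. torsion E (p ^ n))"

text \<open>
  Base change to the algebraic closure, by applying the embedding \<^const>\<open>to_ac\<close> to the coefficients.
  Ordinarity is meant for fields of positive characteristic \<open>CHAR('a)\<close>.
\<close>

definition ordinary :: "'a::field weierstrass \<Rightarrow> bool" where
  "ordinary E \<longleftrightarrow> torsion (map_weierstrass to_ac E) CHAR('a) \<noteq> {Infinity}"

end

theory Submission
  imports Defs "HOL-Library.Set_Algebras"
begin

text \<open>
  Let \<open>E: y\<^sup>2 = f(x)\<close> with \<open>f\<close> cubic, \<open>p = 2 m + 1\<close>, and let \<open>D\<close> be the derivation of the function field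
  with \<open>D x = 2 y\<close>, \<open>D y = f'(x)\<close>. A rational point \<open>P\<close> of order \<open>p\<close> is the same as a function
  \<open>g = a(x) + b(x) y\<close> with divisor \<open>p (P) - p (\<infinity>)\<close>, whose norm \<open>a\<^sup>2 - f b\<^sup>2\<close> is then a multiple of
  \<open>(x - x(P)) ^ p\<close> and so has derivative zero. This forces \<open>D g = 2 \<lambda> g\<close> with a constant \<open>\<lambda> \<noteq> 0\<close> of \<open>K\<close>, that is,
  \<open>2 f a'' + f' a' = 2 \<lambda>\<^sup>2 a\<close>. As \<open>D ^ p\<close> is again a derivation, it is a multiple of \<open>D\<close>, and therefore
  \<open>\<lambda> ^ (p - 1)\<close> depends on \<open>f\<close> alone (it is essentially the Hasse invariant). Twisting by \<open>d\<close>
  multiplies \<open>\<lambda>\<^sup>2\<close> by \<open>d\<close>; hence if \<open>E\<close> and its twist both had rational \<open>p\<close>-torsion,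
  then \<open>d\<close> would be a square times an \<open>m\<close>-th root of unity, and these roots are squares of elements of
  the prime field. A Hilbertian field contains a nonsquare \<open>d\<close>, so at least one of each such pair of
  twists has no rational \<open>p\<close>-torsion.

  Conversely, over the algebraic closure an eigenpolynomial \<open>a\<close> of degree \<open>m\<close> with nonzero eigenvalue yields a
  point of order \<open>p\<close>. For \<open>f = x\<^sup>3 + t x\<^sup>2 + x\<close> it exists unless \<open>t\<close> is a root of a nonzero
  polynomial, so almost all members of this family are ordinary.
\<close>

section \<open>Ideal classes of the coordinate ring\<close>

text \<open>Nonsingularity is recorded as a Bezout identity because the ideal computations use
  explicit cofactors of \<open>F\<close> and \<open>pderiv F\<close>.\<close>

locale cubic =
  fixes A B C :: "'a::field"
  assumes two_nonzero: "(2::'a) \<noteq> 0"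
    and bezout: "\<exists>u v. u * [:C, B, A, 1:] + v * pderiv [:C, B, A, 1:] = 1"
begin

definition F :: "'a poly" where "F = [:C, B, A, 1:]"

abbreviation E :: "'a weierstrass" where "E \<equiv> Weierstrass 0 A 0 B C"

text \<open>
  The function field of \<open>E\<close> depends on the coefficients and so is not a type; it is found inside the
  algebraic closure of \<open>K(x)\<close>, by adjoining a square root \<open>Y\<close> of \<open>F\<close>. The
  set \<open>R\<close> is the coordinate ring \<open>K[x, y]\<close>.
\<close>

definition emb :: "'a poly \<Rightarrow> 'a poly fract alg_closure" where
  "emb u = to_ac (to_fract u)"

definition Y :: "'a poly fract alg_closure" where
  "Y = (SOME y. y ^ 2 = emb F)"

definition R :: "'a poly fract alg_closure set" where
  "R = {emb a + emb b * Y | a b. True}"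

lemma emb_simps [simp]:
  "emb 0 = 0" "emb 1 = 1" "emb (a + b) = emb a + emb b" "emb (a - b) = emb a - emb b"
  "emb (- a) = - emb a" "emb (a * b) = emb a * emb b" "emb a = emb b \<longleftrightarrow> a = b"
  "emb a = 0 \<longleftrightarrow> a = 0"
  by (simp_all add: emb_def)

lemma emb_power [simp]: "emb (a ^ n) = emb a ^ n"
  by (induction n) simp_all

lemma emb_numeral [simp]: "emb (numeral n) = numeral n"
proof -
  have "emb (of_nat k) = of_nat k" for k
    by (induction k) simp_all
  from this[of "numeral n"] show ?thesis
    by simp
qed

lemma Y_sq: "Y ^ 2 = emb F"
  unfolding Y_def by (rule someI_ex) (use nth_root_exists[of 2 "emb F"] in auto)

lemma Y_mult_Y [simp]: "Y * Y = emb F"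
  using Y_sq by (simp add: power2_eq_square)

lemma F_simps [simp]: "F \<noteq> 0" "degree F = 3" "lead_coeff F = 1"
  "poly F x = x ^ 3 + A * x ^ 2 + B * x + C"
  by (simp_all add: F_def algebra_simps power2_eq_square power3_eq_cube)

lemma bezoutE: obtains u v where "u * F + v * pderiv F = 1"
  using bezout unfolding F_def by blast

text \<open>A nonzero solution would equate an even degree with an odd one. So \<open>F\<close> is
  not a square in \<open>K(x)\<close>, which makes 1 and \<open>Y\<close> independent.\<close>

lemma sq_eq_F_sq_imp_0:
  assumes "a ^ 2 = F * b ^ 2"
  shows "a = 0 \<and> b = 0"
proof (cases "b = 0")
  case False
  then have "a \<noteq> 0"
    using assms by auto
  have "degree (a ^ 2) = degree (F * b ^ 2)"
    using assms by simp
  then have "2 * degree a = 3 + 2 * degree b"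
    using False \<open>a \<noteq> 0\<close> by (simp add: degree_mult_eq degree_power_eq)
  then show ?thesis
    by presburger
qed (use assms in auto)

lemma emb_Y_eq_0_iff: "emb a + emb b * Y = 0 \<longleftrightarrow> a = 0 \<and> b = 0"
proof
  assume "emb a + emb b * Y = 0"
  then have "emb a = - (emb b * Y)"
    by (simp add: add_eq_0_iff2)
  then have "emb a * emb a = emb b * emb b * (Y * Y)"
    by (simp add: algebra_simps)
  then have "emb (a ^ 2) = emb (F * b ^ 2)"
    by (simp add: algebra_simps power2_eq_square)
  then show "a = 0 \<and> b = 0"
    using sq_eq_F_sq_imp_0 by (simp del: emb_simps(6) emb_power)
qed auto

lemma emb_Y_eq_iff [simp]: "emb a + emb b * Y = emb c + emb d * Y \<longleftrightarrow> a = c \<and> b = d"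
  using emb_Y_eq_0_iff[of "a - c" "b - d"] by (auto simp: algebra_simps)

lemma RI: "emb a + emb b * Y \<in> R"
  by (auto simp: R_def)

lemma RE: assumes "r \<in> R" obtains a b where "r = emb a + emb b * Y"
  using assms by (auto simp: R_def)

lemma emb_R [simp]: "emb a \<in> R"
  using RI[of a 0] by simp

lemma Y_R [simp]: "Y \<in> R"
  using RI[of 0 1] by simp

lemma R_0 [simp]: "0 \<in> R" and R_1 [simp]: "1 \<in> R"
  using emb_R[of 0] emb_R[of 1] by simp_all

lemma R_numeral [simp]: "numeral n \<in> R"
  using emb_R[of "numeral n"] by simp

lemma R_add [simp]: "r \<in> R \<Longrightarrow> s \<in> R \<Longrightarrow> r + s \<in> R"
proof (elim RE)
  fix a b c d assume "r = emb a + emb b * Y" "s = emb c + emb d * Y"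
  then show "r + s \<in> R"
    using RI[of "a + c" "b + d"] by (simp add: algebra_simps)
qed

lemma mult_emb_Y:
  "(emb a + emb b * Y) * (emb c + emb d * Y) = emb (a * c + F * b * d) + emb (a * d + b * c) * Y"
proof -
  have "(emb a + emb b * Y) * (emb c + emb d * Y)
     = emb a * emb c + emb b * emb d * (Y * Y) + (emb a * emb d + emb b * emb c) * Y"
    by (simp only: algebra_simps)
  then show ?thesis
    by (simp add: algebra_simps)
qed

lemma R_mult [simp]: "r \<in> R \<Longrightarrow> s \<in> R \<Longrightarrow> r * s \<in> R"
proof (elim RE)
  fix a b c d assume "r = emb a + emb b * Y" "s = emb c + emb d * Y"
  then show "r * s \<in> R"
    by (simp only: mult_emb_Y RI)
qed

lemma R_uminus [simp]: "r \<in> R \<Longrightarrow> - r \<in> R"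
  using R_mult[OF emb_R[of "-1"]] by simp

lemma R_diff [simp]: "r \<in> R \<Longrightarrow> s \<in> R \<Longrightarrow> r - s \<in> R"
  using R_add[of r "- s"] by simp

lemma R_power [simp]: "r \<in> R \<Longrightarrow> r ^ n \<in> R"
  by (induction n) simp_all

section \<open>Ideals given by generators, and their classes\<close>

text \<open>
  Ideals of \<open>R\<close> are handled through generating sets: \<open>rspan (S * T)\<close>, with the elementwise product
  of sets, is the product of the ideals generated by \<open>S\<close> and \<open>T\<close>, and \<open>S \<approx> T\<close> below says that the two
  ideals lie in the same class.
\<close>

inductive_set rspan :: "'a poly fract alg_closure set \<Rightarrow> 'a poly fract alg_closure set" for S where
  zero: "0 \<in> rspan S"
| step: "r \<in> R \<Longrightarrow> s \<in> S \<Longrightarrow> v \<in> rspan S \<Longrightarrow> r * s + v \<in> rspan S"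

lemma rspan_add: "u \<in> rspan S \<Longrightarrow> v \<in> rspan S \<Longrightarrow> u + v \<in> rspan S"
  by (induction rule: rspan.induct) (auto simp: add.assoc intro: rspan.step)

lemma rspan_mult: "u \<in> rspan S \<Longrightarrow> r \<in> R \<Longrightarrow> r * u \<in> rspan S"
proof (induction rule: rspan.induct)
  case (step q s v)
  then show ?case
    using rspan.step[of "r * q" s S "r * v"] by (simp add: algebra_simps)
qed (simp add: rspan.zero)

lemma rspan_diff: "u \<in> rspan S \<Longrightarrow> v \<in> rspan S \<Longrightarrow> u - v \<in> rspan S"
  using rspan_add[of u S "(-1) * v"] rspan_mult[of v S "-1"] by simp

lemma rspan_base: "s \<in> S \<Longrightarrow> s \<in> rspan S"
  using rspan.step[of 1 s S 0] by (simp add: rspan.zero)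

lemma rspan_mult_base: "s \<in> S \<Longrightarrow> r \<in> R \<Longrightarrow> r * s \<in> rspan S"
  by (simp add: rspan_base rspan_mult)

lemma rspan_least: "(\<And>s. s \<in> S \<Longrightarrow> s \<in> rspan T) \<Longrightarrow> rspan S \<subseteq> rspan T"
proof
  fix u assume *: "\<And>s. s \<in> S \<Longrightarrow> s \<in> rspan T" and "u \<in> rspan S"
  from this(2) show "u \<in> rspan T"
    by induction (auto intro: rspan.zero rspan_add rspan_mult *)
qed

lemma rspan_eqI:
  "(\<And>s. s \<in> S \<Longrightarrow> s \<in> rspan T) \<Longrightarrow> (\<And>s. s \<in> T \<Longrightarrow> s \<in> rspan S) \<Longrightarrow> rspan S = rspan T"
  by (intro equalityI rspan_least)

lemma rspan_times: "u \<in> rspan S \<Longrightarrow> v \<in> rspan T \<Longrightarrow> u * v \<in> rspan (S * T)"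
proof (induction rule: rspan.induct)
  case (step r s u)
  have "s * v \<in> rspan (S * T)"
    using \<open>v \<in> rspan T\<close>
  proof induction
    case (step q t w)
    have "q * (s * t) + s * w \<in> rspan (S * T)"
      using step \<open>s \<in> S\<close> by (intro rspan.step) auto
    then show ?case
      by (simp add: algebra_simps)
  qed (simp add: rspan.zero)
  then have "r * (s * v) + u * v \<in> rspan (S * T)"
    using step by (auto intro!: rspan_add intro: rspan_mult)
  then show ?case
    by (simp add: algebra_simps)
qed (simp add: rspan.zero)

lemma rspan_times_cong:
  assumes "rspan S = rspan S'" "rspan T = rspan T'"
  shows "rspan (S * T) = rspan (S' * T')"
proof -
  have *: "rspan (S * T) \<subseteq> rspan (S' * T')" if "rspan S = rspan S'" "rspan T = rspan T'" for S S' T T'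
  proof (rule rspan_least)
    fix w assume "w \<in> S * T"
    then obtain s t where "w = s * t" "s \<in> S" "t \<in> T"
      by (rule set_times_elim)
    then show "w \<in> rspan (S' * T')"
      using that rspan_base rspan_times by blast
  qed
  show ?thesis
    using *[OF assms] *[OF assms[symmetric]] by blast
qed

lemma rspan_power_cong: "rspan S = rspan T \<Longrightarrow> rspan (S ^ n) = rspan (T ^ n)"
  by (induction n) (simp_all, rule rspan_times_cong)

lemma rspan_singleton: "u \<in> rspan {g} \<longleftrightarrow> (\<exists>r\<in>R. u = r * g)"
proof
  show "u \<in> rspan {g} \<Longrightarrow> \<exists>r\<in>R. u = r * g"
  proof (induction rule: rspan.induct)
    case (step r s v)
    then obtain q where "q \<in> R" "v = q * g"
      by blast
    then show ?case
      using step by (intro bexI[of _ "r + q"]) (auto simp: algebra_simps)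
  qed (auto intro: bexI[of _ 0])
qed (auto intro: rspan_mult_base)

text \<open>The factor \<open>c\<close> ranges over the whole ambient field; between nonzero ideals
  of \<open>R\<close> it automatically lies in the fraction field of \<open>R\<close>.\<close>

definition equivalent (infix \<open>\<approx>\<close> 50) where
  "S \<approx> T \<longleftrightarrow> (\<exists>c. c \<noteq> 0 \<and> rspan S = rspan ({c} * T))"

lemma equivalentI: "c \<noteq> 0 \<Longrightarrow> rspan S = rspan ({c} * T) \<Longrightarrow> S \<approx> T"
  unfolding equivalent_def by blast

lemma singleton_times [simp]: "{a} * {b} = {a * b :: 'b :: times}"
  by (auto simp: set_times_def)

lemma singleton_power [simp]: "{a} ^ n = {a ^ n :: 'b :: comm_monoid_mult}"
  by (induction n) auto

lemma equivalent_refl: "S \<approx> S"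
  by (rule equivalentI[of 1]) (simp_all flip: set_one)

lemma equivalent_sym: assumes "S \<approx> T" shows "T \<approx> S"
proof -
  obtain c where c: "c \<noteq> 0" "rspan S = rspan ({c} * T)"
    using assms by (auto simp: equivalent_def)
  have "rspan ({inverse c} * S) = rspan ({inverse c} * ({c} * T))"
    using c by (intro rspan_times_cong) auto
  also have "{inverse c} * ({c} * T) = T"
    using c by (simp flip: mult.assoc set_one)
  finally show ?thesis
    using c by (intro equivalentI[of "inverse c"]) auto
qed

lemma equivalent_trans [trans]: assumes "S \<approx> T" "T \<approx> U" shows "S \<approx> U"
proof -
  obtain c d where c: "c \<noteq> 0" "rspan S = rspan ({c} * T)"
    and d: "d \<noteq> 0" "rspan T = rspan ({d} * U)"
    using assms by (auto simp: equivalent_def)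
  have "rspan ({c} * T) = rspan ({c} * ({d} * U))"
    using d by (intro rspan_times_cong) auto
  then show ?thesis
    using c d by (intro equivalentI[of "c * d"]) (auto simp flip: mult.assoc)
qed

lemma equivalent_times: assumes "S \<approx> T" "S' \<approx> T'" shows "S * S' \<approx> T * T'"
proof -
  obtain c d where c: "c \<noteq> 0" "rspan S = rspan ({c} * T)"
    and d: "d \<noteq> 0" "rspan S' = rspan ({d} * T')"
    using assms by (auto simp: equivalent_def)
  have "rspan (S * S') = rspan (({c} * T) * ({d} * T'))"
    using c d by (intro rspan_times_cong) auto
  also have "({c} * T) * ({d} * T') = ({c} * {d}) * (T * T')"
    by (simp only: mult_ac)
  finally show ?thesis
    using c d by (intro equivalentI[of "c * d"]) simp_all
qed

lemma equivalent_power: "S \<approx> T \<Longrightarrow> S ^ n \<approx> T ^ n"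
  by (induction n) (auto intro: equivalent_refl equivalent_times simp del: set_one)

lemma equivalent_1_iff: "S \<approx> 1 \<longleftrightarrow> (\<exists>c. c \<noteq> 0 \<and> rspan S = rspan {c})"
  by (simp add: equivalent_def del: set_one)

text \<open>Generators of the maximal ideal of a point of the curve. Its class corresponds to the
  divisor class of (P) - (infinity), hence the unit ideal for \<open>Infinity\<close>.\<close>

fun gens :: "'a point \<Rightarrow> 'a poly fract alg_closure set" where
  "gens Infinity = 1"
| "gens (Affine x y) = {emb [:-x, 1:], Y - emb [:y:]}"

lemma poly_eq_imp_decomp: 
  assumes "poly w x = y" obtains h where "w = [:y:] + [:-x, 1:] * (h :: 'a poly)"
proof -
  have "poly (w - [:y:]) x = 0"
    using assms by simp
  then have "[:-x, 1:] dvd w - [:y:]"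
    by (simp only: poly_eq_0_iff_dvd)
  then obtain h where "w - [:y:] = [:-x, 1:] * h" ..
  then show ?thesis
    using that[of h] by (simp add: algebra_simps)
qed

text \<open>\<open>w\<close> and its value \<open>y\<close> at \<open>x\<close> differ by a multiple
  of \<open>[:-x, 1:]\<close>. This lets the ideals of all points on a line share the generator
  \<open>Y - emb w\<close>.\<close>

lemma rspan_gens:
  assumes "poly w x = y"
  shows "rspan (gens (Affine x y)) = rspan {emb [:-x, 1:], Y - emb w}"
proof -
  obtain h where h: "w = [:y:] + [:-x, 1:] * h"
    using assms by (rule poly_eq_imp_decomp)
  have 1: "Y - emb [:y:] = 1 * (Y - emb w) + emb h * emb [:-x, 1:]"
    and 2: "Y - emb w = 1 * (Y - emb [:y:]) - emb h * emb [:-x, 1:]"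
    by (simp_all add: h del: mult_pCons_left)
  show ?thesis
  proof (rule rspan_eqI)
    have "Y - emb [:y:] \<in> rspan {emb [:-x, 1:], Y - emb w}"
      unfolding 1 by (intro rspan_add rspan_mult_base) auto
    then show "s \<in> rspan {emb [:-x, 1:], Y - emb w}" if "s \<in> gens (Affine x y)" for s
      using that by (auto intro: rspan_base)
    have "Y - emb w \<in> rspan (gens (Affine x y))"
      unfolding 2 by (intro rspan_diff rspan_mult_base) auto
    then show "s \<in> rspan (gens (Affine x y))" if "s \<in> {emb [:-x, 1:], Y - emb w}" for s
      using that by (auto intro: rspan_base)
  qed
qed

text \<open>
  The three points in which a line meets \<open>E\<close> have a principal product. Writing \<open>l\<close> for the line, the
  ideal divided by \<open>l\<close> contains \<open>F\<close> and \<open>F' ^ 2\<close>, hence 1 by nonsingularity; this treats chords and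
  tangents alike.
\<close>

lemma rspan_line:
  assumes F: "F - w ^ 2 = [:-x1, 1:] * [:-x2, 1:] * [:-x3, 1:]"
  defines "l \<equiv> Y - emb w"
  shows "rspan ({emb [:-x1, 1:], l} * {emb [:-x2, 1:], l} * {emb [:-x3, 1:], l}) = rspan {l}"
    (is "rspan ?S = _")
proof -
  define t1 where "t1 = [:-x1, 1:]"
  define t2 where "t2 = [:-x2, 1:]"
  define t3 where "t3 = [:-x3, 1:]"
  define U where "U = Y + emb w"
  have Fw: "F = w ^ 2 + t1 * t2 * t3"
    using F by (simp add: t1_def t2_def t3_def algebra_simps)
  have S: "?S = {emb t1, l} * {emb t2, l} * {emb t3, l}"
    by (simp add: t1_def t2_def t3_def)
  have inR [simp]: "l \<in> R" "U \<in> R"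
    by (simp_all add: l_def U_def)
  have Ul: "emb t1 * emb t2 * emb t3 = U * l"
  proof -
    have "U * l = Y * Y - emb w * emb w"
      by (simp only: U_def l_def algebra_simps)
    also have "\<dots> = emb t1 * emb t2 * emb t3"
      by (simp add: Fw power2_eq_square)
    finally show ?thesis ..
  qed
  have mem: "a * b * c \<in> rspan ?S" if "a \<in> {emb t1, l}" "b \<in> {emb t2, l}" "c \<in> {emb t3, l}" for a b c
    unfolding S using that by (intro rspan_base set_times_intro)
  have "rspan ?S \<subseteq> rspan {l}"
  proof (rule rspan_least)
    fix s assume "s \<in> ?S"
    then obtain a b c where s: "s = a * b * c" and "a \<in> {emb t1, l}" "b \<in> {emb t2, l}" "c \<in> {emb t3, l}"
      unfolding S by (auto elim!: set_times_elim)
    then have abc: "a = emb t1 \<or> a = l" "b = emb t2 \<or> b = l" "c = emb t3 \<or> c = l" "a \<in> R" "b \<in> R" "c \<in> R"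
      by auto
    then consider "a = l" | "b = l" | "c = l" | "s = U * l"
      using s Ul by auto
    then show "s \<in> rspan {l}"
      using abc s unfolding rspan_singleton
      by cases (auto intro: bexI[of _ "b * c"] bexI[of _ "a * c"] bexI[of _ "a * b"] bexI[of _ U])
  qed
  moreover have "l \<in> rspan ?S"
  proof -
    obtain u v where uv: "u * F + v * pderiv F = 1"
      by (rule bezoutE)
    have "emb t1 * emb t2 * emb t3 \<in> rspan ?S" "l * l * l \<in> rspan ?S"
      by (intro mem; simp)+
    then have Ul': "U * l \<in> rspan ?S" and lll: "l * l * l \<in> rspan ?S"
      by (simp_all only: Ul)
    define h :: "'a poly" where "h = [:1/2:]"
    have h: "h * 2 = 1"
      using two_nonzero by (simp add: h_def numeral_poly one_pCons)
    \<comment> \<open>Since \<open>U - l = 2 w\<close>, the element \<open>4 w ^ 2 l\<close> is a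
      combination of \<open>U l\<close> and \<open>l ^ 3\<close>.\<close>
    have wl: "emb (w ^ 2) * l \<in> rspan ?S"
    proof -
      have "4 * (emb (w ^ 2) * l) = (U - 2 * l) * (U * l) + 1 * (l * l * l)"
        by (simp add: U_def l_def algebra_simps power2_eq_square)
      moreover have "(U - 2 * l) * (U * l) + 1 * (l * l * l) \<in> rspan ?S"
        by (intro rspan_add rspan_mult Ul' lll) auto
      ultimately have "4 * (emb (w ^ 2) * l) \<in> rspan ?S"
        by (simp only:)
      then have "emb (h * h) * (4 * (emb (w ^ 2) * l)) \<in> rspan ?S"
        by (rule rspan_mult) (rule emb_R)
      moreover have "emb (h * h) * (4 * (emb (w ^ 2) * l)) = emb (h * 2) * (emb (h * 2) * (emb (w ^ 2) * l))"
        by simp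
      ultimately show ?thesis
        by (simp only: h emb_simps(2) mult_1)
    qed
    have Fl: "emb F * l \<in> rspan ?S"
    proof -
      have "emb F * l = emb (w ^ 2) * l + l * (U * l)"
        by (simp add: Fw Ul[symmetric] algebra_simps)
      then show ?thesis
        using wl Ul' by (auto intro!: rspan_add rspan_mult simp del: emb_power)
    qed
    \<comment> \<open>Differentiating \<open>F = w ^ 2 + t1 t2 t3\<close> leaves products of two of
      the \<open>t1\<close>, \<open>t2\<close>, \<open>t3\<close>; each of them times
      \<open>l\<close> is a generator.\<close>
    have Dl: "emb (pderiv F - 2 * w * pderiv w) * l \<in> rspan ?S"
    proof -
      have "pderiv F = 2 * w * pderiv w + (t1 * t2 + t1 * t3 + t2 * t3)"
        unfolding Fw power2_eq_square pderiv_add pderiv_mult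
        by (simp add: t1_def t2_def t3_def pderiv_pCons algebra_simps)
      then have "emb (pderiv F - 2 * w * pderiv w) * l
        = emb t1 * emb t2 * l + emb t1 * l * emb t3 + l * emb t2 * emb t3"
        by (simp add: algebra_simps)
      then show ?thesis
        using mem by (auto intro!: rspan_add simp del: emb_simps)
    qed
    \<comment> \<open>The square of the Bezout relation involves only multiples of \<open>F\<close>
      and of \<open>F' ^ 2 = (F' + 2 w w') (F' - 2 w w') + 4 w' ^ 2 w ^ 2\<close>.\<close>
    have "l = emb (u * F + v * pderiv F) * emb (u * F + v * pderiv F) * l"
      by (simp add: uv del: emb_simps(3,6))
    also have "\<dots> = emb (u * u * F + 2 * u * v * pderiv F) * (emb F * l)
        + (emb (v * v * (pderiv F + 2 * w * pderiv w)) * (emb (pderiv F - 2 * w * pderiv w) * l)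
        + emb (4 * v * v * pderiv w * pderiv w) * (emb (w ^ 2) * l))"
      by (simp add: algebra_simps power2_eq_square)
    also have "\<dots> \<in> rspan ?S"
      by (intro rspan_add rspan_mult Fl Dl wl emb_R)
    finally show ?thesis .
  qed
  then have "rspan {l} \<subseteq> rspan ?S"
    by (intro rspan_least) auto
  ultimately show ?thesis
    by blast
qed

text \<open>This is the vertical line through a point. With \<open>F = y ^ 2 + t h\<close>, the
  product divided by \<open>t\<close> contains \<open>t\<close>, \<open>h\<close> and
  \<open>2 y\<close>; modulo these both \<open>F\<close> and \<open>F'\<close> vanish, so it
  contains 1.\<close>

lemma rspan_inverse:
  assumes "y ^ 2 = poly F x"
  shows "rspan (gens (Affine x y) * gens (Affine x (-y))) = rspan {emb [:-x, 1:]}"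
    (is "rspan ?S = _")
proof -
  define t where "t = [:-x, 1:]"
  define e where "e = [:y:]"
  have "poly (F - [:y ^ 2:]) x = 0"
    using assms by simp
  then obtain h where h: "F - [:y ^ 2:] = t * h"
    unfolding poly_eq_0_iff_dvd t_def dvd_def by blast
  have Fh: "F = e * e + t * h"
    using h by (simp add: e_def power2_eq_square algebra_simps)
  have ne: "emb [:- y:] = - emb e"
    by (simp add: e_def flip: emb_simps(5))
  have S: "?S = {emb t, Y - emb e} * {emb t, Y + emb e}"
    by (simp add: t_def ne) (simp add: e_def)
  have Ul: "(Y - emb e) * (Y + emb e) = emb h * emb t"
  proof -
    have "(Y - emb e) * (Y + emb e) = Y * Y - emb e * emb e"
      by (simp only: algebra_simps)
    then show ?thesis
      by (simp add: Fh)
  qed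
  have mem: "a * b \<in> rspan ?S" if "a \<in> {emb t, Y - emb e}" "b \<in> {emb t, Y + emb e}" for a b
    unfolding S using that by (intro rspan_base set_times_intro)
  have "rspan ?S \<subseteq> rspan {emb t}"
  proof (rule rspan_least)
    fix s assume "s \<in> ?S"
    then obtain a b where "s = a * b" "a \<in> {emb t, Y - emb e}" "b \<in> {emb t, Y + emb e}"
      unfolding S by (auto elim!: set_times_elim)
    then show "s \<in> rspan {emb t}"
      unfolding rspan_singleton using Ul 
      by (auto intro: bexI[of _ "emb t"] bexI[of _ "Y + emb e"] bexI[of _ "Y - emb e"] bexI[of _ "emb h"])
  qed
  moreover have "emb t \<in> rspan ?S"
  proof -
    obtain u v where uv: "u * F + v * pderiv F = 1"
      by (rule bezoutE)
    have tt: "emb t * emb t \<in> rspan ?S"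
      by (intro mem) auto
    have ht: "emb h * emb t \<in> rspan ?S"
      unfolding Ul[symmetric] by (intro mem) auto
    have et: "emb (2 * e) * emb t \<in> rspan ?S"
    proof -
      have "emb (2 * e) * emb t = emb t * (Y + emb e) - (Y - emb e) * emb t"
        by (simp add: algebra_simps)
      then show ?thesis
        using mem by (auto intro!: rspan_diff simp del: emb_simps)
    qed
    define g :: "'a poly" where "g = [:1/2:]"
    have g: "2 * (g * q) = q" for q
    proof -
      have "2 * g = 1"
        using two_nonzero by (simp add: g_def numeral_poly one_pCons)
      then show ?thesis
        by (metis mult.assoc mult_1)
    qed
    have dF: "pderiv F = h + t * pderiv h"
      unfolding Fh pderiv_add pderiv_mult by (simp add: e_def t_def pderiv_pCons)
    have "emb t = emb (u * F + v * pderiv F) * emb t"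
      by (simp add: uv del: emb_simps(3,6))
    also have "u * F + v * pderiv F = u * (2 * (g * e)) * e + u * t * h + v * h + v * t * pderiv h"
      unfolding dF g by (simp add: Fh algebra_simps)
    also have "emb \<dots> * emb t = emb (u * g * e) * (emb (2 * e) * emb t) 
        + (emb (u * t + v) * (emb h * emb t) + emb (v * pderiv h) * (emb t * emb t))"
      by (simp add: algebra_simps)
    also have "\<dots> \<in> rspan ?S"
      by (intro rspan_add rspan_mult et ht tt emb_R)
    finally show ?thesis .
  qed
  then have "rspan {emb t} \<subseteq> rspan ?S"
    by (intro rspan_least) auto
  ultimately show ?thesis
    by (simp add: t_def)
qed

section \<open>The group law and ideal classes\<close>

definition vanishes :: "'a \<Rightarrow> 'a \<Rightarrow> 'a poly fract alg_closure \<Rightarrow> bool" where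
  "vanishes x y u \<longleftrightarrow> (\<exists>a b. u = emb a + emb b * Y \<and> poly a x + poly b x * y = 0)"

lemma vanishes_iff [simp]: "vanishes x y (emb a + emb b * Y) \<longleftrightarrow> poly a x + poly b x * y = 0"
  unfolding vanishes_def by (subst emb_Y_eq_iff) blast

lemma vanishes_emb [simp]: "vanishes x y (emb a) \<longleftrightarrow> poly a x = 0"
  using vanishes_iff[of x y a 0] by simp

lemma vanishes_Y_diff [simp]: "vanishes x y (Y - emb a) \<longleftrightarrow> poly a x = y"
  using vanishes_iff[of x y "-a" 1] by (auto simp: algebra_simps)

lemma vanishes_add: "vanishes x y u \<Longrightarrow> vanishes x y v \<Longrightarrow> vanishes x y (u + v)"
proof -
  assume "vanishes x y u" "vanishes x y v"
  then obtain a b c d where "u = emb a + emb b * Y" "poly a x + poly b x * y = 0"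
    "v = emb c + emb d * Y" "poly c x + poly d x * y = 0"
    by (auto simp: vanishes_def)
  moreover have "emb a + emb b * Y + (emb c + emb d * Y) = emb (a + c) + emb (b + d) * Y"
    by (simp add: algebra_simps)
  moreover have "poly (a + c) x + poly (b + d) x * y
      = (poly a x + poly b x * y) + (poly c x + poly d x * y)"
    by (simp add: algebra_simps)
  ultimately show ?thesis
    by (metis add_0 vanishes_iff)
qed

lemma vanishes_mult_iff:
  assumes "y ^ 2 = poly F x" "u \<in> R" "v \<in> R"
  shows "vanishes x y (u * v) \<longleftrightarrow> vanishes x y u \<or> vanishes x y v"
proof -
  obtain a b c d where uv: "u = emb a + emb b * Y" "v = emb c + emb d * Y"
    using assms(2,3) by (elim RE)
  have "poly (a * c + F * b * d) x + poly (a * d + b * c) x * y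
      = (poly a x + poly b x * y) * (poly c x + poly d x * y)"
    unfolding poly_add poly_mult assms(1)[symmetric] by (simp add: algebra_simps power2_eq_square)
  then show ?thesis
    unfolding uv mult_emb_Y vanishes_iff by simp
qed

lemma vanishes_power:
  assumes "y ^ 2 = poly F x" "u \<in> R" "vanishes x y (u ^ n)"
  shows "vanishes x y u"
  using assms(3)
proof (induction n)
  case 0
  then show ?case
    using vanishes_emb[of x y 1] by simp
next
  case (Suc n)
  then show ?case
    using vanishes_mult_iff[of y x u "u ^ n"] assms by auto
qed

lemma vanishes_rspan:
  assumes "y ^ 2 = poly F x" "\<And>s. s \<in> S \<Longrightarrow> vanishes x y s" "S \<subseteq> R" "u \<in> rspan S"
  shows "vanishes x y u"
  using assms(4)
proof induction
  case zero
  show ?case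
    using vanishes_emb[of x y 0] by simp
next
  case (step r s v)
  then show ?case
    using assms by (intro vanishes_add) (auto simp: vanishes_mult_iff)
qed

lemma one_notin_rspan_gens:
  assumes "y ^ 2 = poly F x"
  shows "1 \<notin> rspan (gens (Affine x y))"
proof
  assume "1 \<in> rspan (gens (Affine x y))"
  then have "vanishes x y 1"
    by (rule vanishes_rspan[OF assms, rotated 2]) auto
  then show False
    using vanishes_emb[of x y 1] by simp
qed

text \<open>Leading terms cannot cancel, one degree being even and the other odd. The value is the
  pole order of \<open>a + b y\<close> at infinity.\<close>

lemma degree_norm:
  "degree (a ^ 2 - F * b ^ 2) = (if b = 0 then 2 * degree a else max (2 * degree a) (2 * degree b + 3))"
proof (cases "a = 0 \<or> b = 0")
  case True
  then show ?thesis
    by (cases "a = 0"; cases "b = 0") (simp_all add: degree_mult_eq degree_power_eq)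
next
  case False
  have "degree (a ^ 2 + - (F * b ^ 2)) = max (2 * degree a) (2 * degree b + 3)"
  proof (cases "2 * degree a < 2 * degree b + 3")
    case True
    then show ?thesis
      using False by (subst degree_add_eq_right) (auto simp: degree_mult_eq degree_power_eq)
  next
    case not_less: False
    have "2 * degree a \<noteq> 2 * degree b + 3"
      by presburger
    then show ?thesis
      using False not_less by (subst degree_add_eq_left) (auto simp: degree_mult_eq degree_power_eq)
  qed
  then show ?thesis
    using False by simp
qed

text \<open>The norm of a generator divides \<open>t ^ 2\<close>, and no norm has degree 1. So the
  generator is a unit, or a constant multiple of \<open>t\<close>, which does not divide
  \<open>Y - y\<close>. Here the genus of the curve enters.\<close>

lemma gens_not_principal:
  assumes "y ^ 2 = poly F x"
  shows "\<not> gens (Affine x y) \<approx> 1"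
proof
  assume "gens (Affine x y) \<approx> 1"
  then obtain g where g: "rspan (gens (Affine x y)) = rspan {g}"
    unfolding equivalent_1_iff by blast
  define t where "t = [:-x, 1:]"
  have "emb t \<in> rspan {g}" "Y - emb [:y:] \<in> rspan {g}"
    unfolding g[symmetric] by (auto simp: t_def intro: rspan_base)
  then obtain r s where r: "r \<in> R" "emb t = r * g" and s: "s \<in> R" "Y - emb [:y:] = s * g"
    by (auto simp: rspan_singleton)
  have "rspan (gens (Affine x y)) \<subseteq> R"
  proof
    fix u assume "u \<in> rspan (gens (Affine x y))"
    then show "u \<in> R"
      by induction auto
  qed
  moreover have "g \<in> rspan {g}"
    by (auto intro: rspan_base)
  ultimately have "g \<in> R"
    using g by auto
  then obtain a b where ab: "g = emb a + emb b * Y"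
    by (rule RE)
  obtain c d where cd: "r = emb c + emb d * Y"
    using r(1) by (rule RE)
  obtain c' d' where cd': "s = emb c' + emb d' * Y"
    using s(1) by (rule RE)
  have "emb t + emb 0 * Y = emb (c * a + F * d * b) + emb (c * b + d * a) * Y"
    using r(2) unfolding ab cd mult_emb_Y by simp
  then have t: "t = c * a + F * d * b" and z: "c * b + d * a = 0"
    unfolding emb_Y_eq_iff by simp_all
  define e where "e = [:y:]"
  have "emb (- e) + emb 1 * Y = emb (c' * a + F * d' * b) + emb (c' * b + d' * a) * Y"
    using s(2) unfolding ab cd' mult_emb_Y e_def[symmetric] by simp
  then have one: "c' * b + d' * a = 1"
    unfolding emb_Y_eq_iff by simp
  have "t ^ 2 = (c * a + F * d * b) ^ 2 - F * (c * b + d * a) ^ 2"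
    using t z by simp
  also have "\<dots> = (a ^ 2 - F * b ^ 2) * (c ^ 2 - F * d ^ 2)"
    by (simp add: power2_eq_square algebra_simps)
  finally have tt: "t ^ 2 = (a ^ 2 - F * b ^ 2) * (c ^ 2 - F * d ^ 2)" .
  have t0: "t ^ 2 \<noteq> 0" "degree (t ^ 2) = 2"
    by (simp_all add: t_def degree_power_eq)
  then have "degree (a ^ 2 - F * b ^ 2) + degree (c ^ 2 - F * d ^ 2) = 2"
    using tt by (metis degree_mult_eq mult_eq_0_iff)
  then consider "b = 0" "degree a = 0" | "d = 0" "degree c = 0" "b = 0"
    unfolding degree_norm by (auto split: if_splits simp: max_def) linarith
  then show False
  proof cases
    case 1
    then obtain k where k: "a = [:k:]"
      by (metis degree_eq_zeroE)
    have "k \<noteq> 0"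
      using tt t0 1 k by auto
    then have "[:1 / k:] * a = 1"
      by (simp add: k one_pCons)
    then have "1 = emb [:1 / k:] * g"
      unfolding ab 1 emb_simps mult_zero_left add_0_right by (metis emb_simps(2,6))
    then have "1 \<in> rspan {g}"
      by (auto simp: rspan_singleton)
    then show False
      using g one_notin_rspan_gens[OF assms] by blast
  next
    case 2
    then obtain k where k: "c = [:k:]"
      by (metis degree_eq_zeroE)
    have "degree a = 0"
      using one 2 by (metis add_0 degree_1 degree_mult_eq gr_zeroI
          add_is_0 mult_zero_left mult_zero_right zero_neq_one)
    then have "degree t = 0"
      using t 2 k by simp
    then show False
      by (simp add: t_def)
  qed
qed

section \<open>The chord and tangent law in the class group\<close>

lemma on_curve_iff: "on_curve E (Affine x y) \<longleftrightarrow> y ^ 2 = poly F x"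
  by simp

lemma gens_neg: 
  assumes "y ^ 2 = poly F x"
  shows "gens (Affine x y) * gens (Affine x (-y)) \<approx> 1"
  unfolding equivalent_1_iff using rspan_inverse[OF assms] by (intro exI[of _ "emb [:-x,1:]"]) auto

lemma equivalent_mult_1: "S \<approx> 1 \<Longrightarrow> T * S \<approx> T"
  using equivalent_times[OF equivalent_refl[of T], of S 1] by (simp del: set_one)

text \<open>The line meets the curve in a third point \<open>(x3, - y3)\<close>, so the three ideals
  have a principal product; the class of that point is cancelled against the class of its inverse
  \<open>(x3, y3)\<close>.\<close>

lemma collinear:
  assumes "F - w ^ 2 = [:-x1, 1:] * [:-x2, 1:] * [:-x3, 1:]"
    and "poly w x1 = y1" "poly w x2 = y2" "poly w x3 = - y3"
  shows "on_curve E (Affine x3 y3)"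
    and "gens (Affine x1 y1) * gens (Affine x2 y2) \<approx> gens (Affine x3 y3)"
proof -
  have "poly (F - w ^ 2) x3 = 0"
    unfolding assms(1) by simp
  then have y3: "y3 ^ 2 = poly F x3"
    unfolding poly_diff poly_power assms(4) by (simp del: F_simps)
  then show "on_curve E (Affine x3 y3)"
    by (simp add: on_curve_iff)
  let ?P = "gens (Affine x1 y1)" and ?Q = "gens (Affine x2 y2)"
    and ?S = "gens (Affine x3 (-y3))" and ?T = "gens (Affine x3 y3)"
  have "rspan (?P * ?Q * ?S) = rspan {Y - emb w}"
    using rspan_line[OF assms(1)] rspan_gens[OF assms(2)] rspan_gens[OF assms(3)] rspan_gens[OF assms(4)]
    by (metis rspan_times_cong)
  moreover have "Y - emb w \<noteq> 0"
    using emb_Y_eq_0_iff[of "-w" 1] by (simp add: algebra_simps)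
  ultimately have PQS: "?P * ?Q * ?S \<approx> 1"
    unfolding equivalent_1_iff by blast
  have "?P * ?Q \<approx> ?P * ?Q * (?T * ?S)"
    by (rule equivalent_sym[OF equivalent_mult_1[OF gens_neg[OF y3]]])
  also have "\<dots> = ?T * (?P * ?Q * ?S)"
    by (simp only: mult_ac)
  also have "\<dots> \<approx> ?T"
    by (rule equivalent_mult_1[OF PQS])
  finally show "?P * ?Q \<approx> ?T" .
qed

text \<open>The condition on \<open>m (y1 + y2)\<close> is the divided difference of
  \<open>F\<close> at \<open>x1\<close> and \<open>x2\<close>; for equal points it reads
  \<open>F'(x1) = 2 m y1\<close>. Thus one identity serves chords and tangents.\<close>

lemma slope_factorization:
  assumes "y1 ^ 2 = poly F x1"
    and "y2 = y1 + m * (x2 - x1)"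
    and "x1 ^ 2 + x1 * x2 + x2 ^ 2 + A * (x1 + x2) + B = m * (y1 + y2)"
    and "x3 = m ^ 2 - A - x1 - x2"
  shows "F - [:y1 - m * x1, m:] ^ 2 = [:-x1, 1:] * [:-x2, 1:] * [:-x3, 1:]"
proof -
  have B: "B = m * (y1 + y2) - (x1 ^ 2 + x1 * x2 + x2 ^ 2 + A * (x1 + x2))"
    using assms(3) by (simp add: algebra_simps)
  have C: "C = y1 ^ 2 - x1 ^ 3 - A * x1 ^ 2 - B * x1"
    using assms(1) by (simp add: algebra_simps)
  show ?thesis
    unfolding F_def unfolding C unfolding B assms(2,4) by (simp add: algebra_simps power2_eq_square power3_eq_cube)
qed

text \<open>The map from points to ideal classes respects addition, which turns multiples of a point
  into powers of its ideal.\<close>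

theorem point_add_gens:
  assumes "on_curve E P" "on_curve E Q"
  shows "on_curve E (point_add E P Q) \<and> gens P * gens Q \<approx> gens (point_add E P Q)"
proof (cases P; cases Q)
  fix x1 y1 x2 y2
  assume PQ: "P = Affine x1 y1" "Q = Affine x2 y2"
  have y1: "y1 ^ 2 = poly F x1" and y2: "y2 ^ 2 = poly F x2"
    using assms unfolding PQ on_curve_iff by auto
  show ?thesis
  proof (cases "x1 = x2 \<and> y1 + y2 = 0")
    case True
    then have "y2 = - y1"
      by (simp add: eq_neg_iff_add_eq_0 add.commute)
    then show ?thesis
      using True PQ gens_neg[OF y1] by simp
  next
    case False
    define m where "m = (if x1 = x2 then (3 * x1 ^ 2 + 2 * A * x1 + B) / (2 * y1) else (y2 - y1) / (x2 - x1))"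
    define x3 where "x3 = m ^ 2 - A - x1 - x2"
    define y3 where "y3 = - (y1 + m * (x3 - x1))"
    have add: "point_add E P Q = Affine x3 y3"
      using False by (simp add: PQ m_def x3_def y3_def Let_def)
    have *: "y2 = y1 + m * (x2 - x1) \<and>
      x1 ^ 2 + x1 * x2 + x2 ^ 2 + A * (x1 + x2) + B = m * (y1 + y2)"
    proof (cases "x1 = x2")
      case True
      then have "y1 ^ 2 = y2 ^ 2"
        using y1 y2 by simp
      then have "y1 = y2"
        using False True by (auto simp: power2_eq_iff)
      moreover from this have "2 * y1 \<noteq> 0"
        using False True by auto
      then have "m * (2 * y1) = 3 * x1 ^ 2 + 2 * A * x1 + B"
        using True by (simp add: m_def)
      ultimately show ?thesis
        using True by (simp add: algebra_simps power2_eq_square)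
    next
      case neq: False
      then have m: "m * (x2 - x1) = y2 - y1"
        by (simp add: m_def)
      have "(x2 - x1) * (x1 ^ 2 + x1 * x2 + x2 ^ 2 + A * (x1 + x2) + B) = poly F x2 - poly F x1"
        by (simp add: algebra_simps power2_eq_square power3_eq_cube)
      also have "\<dots> = (y2 - y1) * (y1 + y2)"
        unfolding y1[symmetric] y2[symmetric] by (simp add: algebra_simps power2_eq_square)
      also have "\<dots> = (x2 - x1) * (m * (y1 + y2))"
        unfolding m[symmetric] by simp
      finally show ?thesis
        using neq m by simp
    qed
    note fac = slope_factorization[OF y1 conjunct1[OF *] conjunct2[OF *] x3_def]
    have "poly [:y1 - m * x1, m:] x1 = y1" "poly [:y1 - m * x1, m:] x2 = y2"
      "poly [:y1 - m * x1, m:] x3 = - y3"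
      using * by (simp_all add: y3_def algebra_simps)
    from collinear[OF fac this] show ?thesis
      unfolding add unfolding PQ by blast
  qed
qed (use assms in \<open>auto intro: equivalent_refl simp del: set_one\<close>)

lemma point_mult_gens:
  assumes "on_curve E P"
  shows "on_curve E (point_mult E n P) \<and> gens P ^ n \<approx> gens (point_mult E n P)"
proof (induction n)
  case (Suc n)
  have "gens P ^ Suc n \<approx> gens P * gens (point_mult E n P)"
    using Suc by (auto intro: equivalent_times equivalent_refl)
  also have "\<dots> \<approx> gens (point_mult E (Suc n) P)"
    using point_add_gens[OF assms] Suc by simp
  finally show ?case
    using point_add_gens[OF assms] Suc by simp
qed (simp add: equivalent_refl del: set_one)

lemma gens_equivalent_1_iff: "on_curve E P \<Longrightarrow> gens P \<approx> 1 \<longleftrightarrow> P = Infinity"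
  using gens_not_principal on_curve_iff
  by (cases P) (auto simp: equivalent_refl simp del: set_one gens.simps(2) on_curve.simps(2) F_simps)

text \<open>Only \<open>Infinity\<close> has a principal ideal, by
  \<open>gens_not_principal\<close>, so torsion can be read off in the class group.\<close>

theorem point_mult_eq_Infinity_iff:
  assumes "on_curve E P"
  shows "point_mult E n P = Infinity \<longleftrightarrow> gens P ^ n \<approx> 1"
  using point_mult_gens[OF assms, of n] gens_equivalent_1_iff[of "point_mult E n P"]
  by (metis equivalent_sym equivalent_trans)

text \<open>If \<open>p ^ (n + 1)\<close> kills \<open>P\<close>, then \<open>p ^ n P\<close> is
  killed by \<open>p\<close>, as seen on ideal classes; so it is \<open>Infinity\<close>, and the
  exponent descends.\<close>

lemma power_torsion_trivial:
  assumes "torsion E p = {Infinity}"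
  shows "power_torsion E p = {Infinity}"
proof -
  have "P = Infinity" if "on_curve E P" "point_mult E (p ^ n) P = Infinity" for P n
    using that
  proof (induction n arbitrary: P)
    case 0
    then show ?case
      by (cases P) auto
  next
    case (Suc n)
    let ?Q = "point_mult E (p ^ n) P"
    have Q: "on_curve E ?Q" "gens P ^ (p ^ n) \<approx> gens ?Q"
      using point_mult_gens[OF Suc.prems(1)] by blast+
    have "gens ?Q ^ p \<approx> (gens P ^ (p ^ n)) ^ p"
      by (rule equivalent_power[OF equivalent_sym[OF Q(2)]])
    also have "\<dots> = gens P ^ (p ^ Suc n)"
      by (simp add: mult.commute flip: power_mult)
    also have "\<dots> \<approx> 1"
      using Suc.prems point_mult_eq_Infinity_iff by blast
    finally have "point_mult E p ?Q = Infinity"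
      using Q point_mult_eq_Infinity_iff by blast
    then have "?Q \<in> torsion E p"
      using Q by (simp add: torsion_def)
    then show ?case
      using Suc assms by simp
  qed
  moreover have "point_mult E n Infinity = Infinity" for n
    by (induction n) auto
  ultimately show ?thesis
    unfolding power_torsion_def torsion_def by (auto intro!: exI[of _ 1])
qed

end

section \<open>The eigenvalue attached to a rational point of order p\<close>

lemma degree_pderiv_le_pred: "degree (pderiv q) \<le> degree q - 1" for q :: "'a :: {comm_semiring_1, semiring_no_zero_divisors} poly"
  by (rule degree_le) (auto simp: coeff_pderiv coeff_eq_0)

lemma pderiv_nonzero_imp_degree: "pderiv q \<noteq> 0 \<Longrightarrow> degree q \<noteq> 0"
proof
  assume "pderiv q \<noteq> 0" "degree q = 0"
  from this(2) obtain c where "q = [:c:]"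
    by (rule degree_eq_zeroE)
  then show False
    using \<open>pderiv q \<noteq> 0\<close> by (simp add: pderiv_pCons)
qed

lemma linear_power_dvd_mult_cancel:
  fixes q r :: "'a::field poly"
  assumes "[:-x, 1:] ^ n dvd q * r" "poly q x \<noteq> 0"
  shows "[:-x, 1:] ^ n dvd r"
proof (cases "r = 0")
  case False
  have "q \<noteq> 0"
    using assms(2) by auto
  then have "order x (q * r) = order x r"
    using assms(2) False by (simp add: order_mult order_0I)
  then show ?thesis
    using assms(1) False \<open>q \<noteq> 0\<close> by (simp add: order_divides)
qed auto

lemma of_nat_less_CHAR_nonzero:
  assumes "CHAR('a::semiring_1) = p" "0 < k" "k < p"
  shows "of_nat k \<noteq> (0 :: 'a)"
  using assms by (auto simp: of_nat_eq_0_iff_char_dvd dest: dvd_imp_le)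

section \<open>Conjugation and norms\<close>

context cubic
begin

definition conjugate :: "'a poly fract alg_closure \<Rightarrow> 'a poly fract alg_closure" where
  "conjugate u = (THE v. \<exists>a b. u = emb a + emb b * Y \<and> v = emb a - emb b * Y)"

lemma conjugate_eq [simp]: "conjugate (emb a + emb b * Y) = emb a - emb b * Y"
  unfolding conjugate_def by (rule the_equality) auto

lemma conjugate_emb [simp]: "conjugate (emb a) = emb a"
  using conjugate_eq[of a 0] by simp

lemma conjugate_R [simp]: "u \<in> R \<Longrightarrow> conjugate u \<in> R"
  by (elim RE) simp

lemma conjugate_add: "u \<in> R \<Longrightarrow> v \<in> R \<Longrightarrow> conjugate (u + v) = conjugate u + conjugate v"
proof (elim RE)
  fix a b c d assume *: "u = emb a + emb b * Y" "v = emb c + emb d * Y"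
  have "u + v = emb (a + c) + emb (b + d) * Y"
    by (simp add: * algebra_simps)
  then show "conjugate (u + v) = conjugate u + conjugate v"
    by (simp only: conjugate_eq) (simp add: * algebra_simps)
qed

lemma conjugate_mult: "u \<in> R \<Longrightarrow> v \<in> R \<Longrightarrow> conjugate (u * v) = conjugate u * conjugate v"
proof (elim RE)
  fix a b c d assume *: "u = emb a + emb b * Y" "v = emb c + emb d * Y"
  have "conjugate u * conjugate v = (emb a + emb (-b) * Y) * (emb c + emb (-d) * Y)"
    by (simp add: *)
  also have "\<dots> = emb (a * c + F * b * d) - emb (a * d + b * c) * Y"
    unfolding mult_emb_Y by (simp add: algebra_simps)
  finally show "conjugate (u * v) = conjugate u * conjugate v"
    unfolding * mult_emb_Y conjugate_eq by simp
qed

lemma set_times_subset_R: "S \<subseteq> R \<Longrightarrow> T \<subseteq> R \<Longrightarrow> S * T \<subseteq> R"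
  by (blast elim: set_times_elim intro: R_mult)

lemma set_power_subset_R: "S \<subseteq> R \<Longrightarrow> S ^ n \<subseteq> R"
  by (induction n) (simp_all add: set_times_subset_R)

lemma conjugate_image_times: "S \<subseteq> R \<Longrightarrow> T \<subseteq> R \<Longrightarrow> conjugate ` (S * T) = conjugate ` S * conjugate ` T"
proof (intro equalityI subsetI)
  fix u assume ST: "S \<subseteq> R" "T \<subseteq> R"
  show "u \<in> conjugate ` S * conjugate ` T" if u: "u \<in> conjugate ` (S * T)"
  proof -
    obtain s t where "u = conjugate (s * t)" "s \<in> S" "t \<in> T"
      using u by (auto elim!: set_times_elim)
    then show ?thesis
      using ST by (auto simp: conjugate_mult subset_iff)
  qed
  show "u \<in> conjugate ` (S * T)" if u: "u \<in> conjugate ` S * conjugate ` T"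
  proof -
    obtain s t where "u = conjugate s * conjugate t" "s \<in> S" "t \<in> T"
      using u by (auto elim!: set_times_elim)
    then show ?thesis
      using ST by (auto simp: subset_iff simp flip: conjugate_mult)
  qed
qed

lemma conjugate_image_power: "S \<subseteq> R \<Longrightarrow> conjugate ` (S ^ n) = (conjugate ` S) ^ n"
proof (induction n)
  case 0
  show ?case
    using conjugate_emb[of 1] by simp
next
  case (Suc n)
  then show ?case
    by (simp add: conjugate_image_times set_power_subset_R)
qed

lemma rspan_subset_R: "S \<subseteq> R \<Longrightarrow> rspan S \<subseteq> R"
proof
  fix u assume "S \<subseteq> R" "u \<in> rspan S"
  from this(2,1) show "u \<in> R"
    by induction auto
qed

lemma conjugate_rspan:
  assumes "S \<subseteq> R" "u \<in> rspan S" shows "conjugate u \<in> rspan (conjugate ` S)"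
  using assms(2)
proof induction
  case zero
  show ?case
    using conjugate_emb[of 0] by (simp add: rspan.zero)
next
  case (step r s v)
  then have "r \<in> R" "s \<in> R" "v \<in> R"
    using assms(1) rspan_subset_R by auto
  then show ?case
    using step by (auto simp: conjugate_add conjugate_mult intro!: rspan.step)
qed

lemma conjugate_rspan_cong:
  assumes "S \<subseteq> R" "T \<subseteq> R" "rspan S = rspan T"
  shows "rspan (conjugate ` S) = rspan (conjugate ` T)"
proof -
  have "rspan (conjugate ` S) \<subseteq> rspan (conjugate ` T)"
    if "S \<subseteq> R" "T \<subseteq> R" "rspan S = rspan T" for S T
  proof (rule rspan_least)
    fix u assume "u \<in> conjugate ` S"
    then obtain s where "u = conjugate s" "s \<in> S"
      by blast
    moreover from this have "s \<in> rspan T"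
      using that(3) rspan_base by blast
    ultimately show "u \<in> rspan (conjugate ` T)"
      using conjugate_rspan that by blast
  qed
  then show ?thesis
    using assms by (metis subset_antisym)
qed

lemma gens_subset_R: "gens P \<subseteq> R"
  by (cases P) auto

lemma rspan_conjugate_gens: "rspan (conjugate ` gens (Affine x y)) = rspan (gens (Affine x (-y)))"
proof -
  define e where "e = [:y:]"
  have e: "[:-y:] = - e"
    by (simp add: e_def)
  have c: "conjugate (Y - emb e) = (-1) * (Y + emb e)"
    using conjugate_eq[of "-e" 1] by (simp add: algebra_simps)
  have im: "conjugate ` gens (Affine x y) = {emb [:-x, 1:], (-1) * (Y + emb e)}"
    unfolding gens.simps e_def[symmetric] image_insert c by simp
  have g: "gens (Affine x (-y)) = {emb [:-x, 1:], Y + emb e}"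
    unfolding gens.simps e by simp
  show ?thesis
    unfolding im g
  proof (rule rspan_eqI)
    have "(-1) * (Y + emb e) \<in> rspan {emb [:-x, 1:], Y + emb e}"
      by (intro rspan_mult_base) auto
    then show "s \<in> rspan {emb [:-x, 1:], Y + emb e}" if "s \<in> {emb [:-x, 1:], (-1) * (Y + emb e)}" for s
      using that rspan_base[of "emb [:-x, 1:]"] by blast
    have "(-1) * ((-1) * (Y + emb e)) \<in> rspan {emb [:-x, 1:], (-1) * (Y + emb e)}"
      by (intro rspan_mult rspan_base) auto
    also have "(-1) * ((-1) * (Y + emb e)) = Y + emb e"
      by simp
    finally show "s \<in> rspan {emb [:-x, 1:], (-1) * (Y + emb e)}" if "s \<in> {emb [:-x, 1:], Y + emb e}" for s
      using that rspan_base[of "emb [:-x, 1:]"] by blast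
  qed
qed

lemma dvd_antisym_poly_field:
  fixes q r :: "'a poly"
  assumes "q dvd r" "r dvd q" "r \<noteq> 0"
  obtains c where "c \<noteq> 0" "q = smult c r"
proof -
  obtain s where s: "q = r * s"
    using assms(2) ..
  have "degree q = degree r"
    using assms by (intro antisym dvd_imp_degree_le) auto
  moreover have "q \<noteq> 0"
    using assms by auto
  ultimately have "degree s = 0"
    using s assms(3) by (auto simp: degree_mult_eq)
  then obtain c where "s = [:c:]"
    by (metis degree_eq_zeroE)
  then show ?thesis
    using that[of c] s \<open>q \<noteq> 0\<close> by auto
qed

text \<open>The ideal of the point times its conjugate is generated by \<open>t\<close>. So the norm
  of a generator and \<open>t ^ n\<close> generate the same ideal, and as polynomials they agree up
  to a constant.\<close>

lemma principal_power_norm: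
  assumes y: "y ^ 2 = poly F x" and "gens (Affine x y) ^ n \<approx> 1"
  obtains a b c where "rspan (gens (Affine x y) ^ n) = rspan {emb a + emb b * Y}"
    "c \<noteq> 0" "a ^ 2 - F * b ^ 2 = smult c ([:-x, 1:] ^ n)"
proof -
  define t where "t = [:-x, 1:]"
  let ?P = "gens (Affine x y)" and ?Q = "gens (Affine x (-y))"
  have PR: "?P ^ n \<subseteq> R"
    by (intro set_power_subset_R gens_subset_R)
  obtain g where g: "rspan (?P ^ n) = rspan {g}"
    using assms(2) unfolding equivalent_1_iff by blast
  have "g \<in> rspan {g}"
    by (auto intro: rspan_base)
  then have "g \<in> R"
    using g rspan_subset_R[OF PR] by blast
  then obtain a b where ab: "g = emb a + emb b * Y"
    by (rule RE)
  define N where "N = a ^ 2 - F * b ^ 2"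
  have "g * conjugate g = (emb a + emb b * Y) * (emb a + emb (-b) * Y)"
    by (simp add: ab)
  also have "\<dots> = emb N"
    unfolding mult_emb_Y by (simp add: N_def power2_eq_square algebra_simps)
  finally have gN: "g * conjugate g = emb N" .
  have "rspan ((conjugate ` ?P) ^ n) = rspan {conjugate g}"
    using conjugate_rspan_cong[OF PR _ g] \<open>g \<in> R\<close> by (simp add: conjugate_image_power gens_subset_R del: gens.simps)
  then have "rspan (?Q ^ n) = rspan {conjugate g}"
    using rspan_power_cong[OF rspan_conjugate_gens] by metis
  then have "rspan (?P ^ n * ?Q ^ n) = rspan ({g} * {conjugate g})"
    using g by (intro rspan_times_cong)
  then have "rspan ((?P * ?Q) ^ n) = rspan {emb N}"
    by (simp add: power_mult_distrib gN del: gens.simps)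
  moreover have "rspan ((?P * ?Q) ^ n) = rspan ({emb t} ^ n)"
    unfolding t_def by (intro rspan_power_cong rspan_inverse y)
  ultimately have eq: "rspan {emb N} = rspan {emb (t ^ n)}"
    by simp
  have dvd: "q dvd r" if "emb r \<in> rspan {emb q}" for q r
  proof -
    obtain s where "s \<in> R" "emb r = s * emb q"
      using \<open>emb r \<in> rspan {emb q}\<close> by (auto simp: rspan_singleton)
    moreover from this obtain c d where "s = emb c + emb d * Y"
      by (elim RE)
    ultimately have "emb r + emb 0 * Y = emb (c * q) + emb (d * q) * Y"
      by (simp add: algebra_simps)
    then show ?thesis
      unfolding emb_Y_eq_iff by simp
  qed
  have "N dvd t ^ n" "t ^ n dvd N"
    using eq rspan_base[of "emb N" "{emb N}"] rspan_base[of "emb (t ^ n)" "{emb (t ^ n)}"]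
    by (auto intro!: dvd simp del: emb_power)
  moreover have "t ^ n \<noteq> 0"
    by (simp add: t_def)
  ultimately obtain c where "c \<noteq> 0" "N = smult c (t ^ n)"
    by (rule dvd_antisym_poly_field)
  then show ?thesis
    using that g by (auto simp: ab N_def t_def)
qed

text \<open>
  Excludes the eigenvalue 0: the hypothesis says \<open>D (b y) = 0\<close>, and then \<open>F\<close> divides \<open>b\<close> more and
  more often as long as the degree of \<open>b\<close> is small.
\<close>

lemma F_power_dvd_imp_Suc:
  assumes "2 * F * pderiv b + pderiv F * b = 0" "F ^ k dvd b" "of_nat (2 * k + 1) \<noteq> (0 :: 'a)"
  shows "F ^ Suc k dvd b"
proof -
  obtain c where c: "b = F ^ k * c"
    using assms(2) ..
  have Fk: "F * pderiv (F ^ k) = of_nat k * F ^ k * pderiv F"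
    by (cases k) (simp_all add: pderiv_power_Suc of_nat_poly del: power_Suc, simp add: mult_ac)
  \<comment> \<open>Substituting \<open>b = F ^ k c\<close> and cancelling \<open>F ^ k\<close>
    leaves \<open>(2 k + 1) F' c + 2 F c' = 0\<close>; as \<open>F\<close> is prime to
    \<open>F'\<close>, it divides \<open>c\<close>.\<close>
  have "F ^ k * (of_nat (2 * k + 1) * pderiv F * c + 2 * F * pderiv c)
      = 2 * (F * pderiv (F ^ k)) * c + 2 * F * F ^ k * pderiv c + pderiv F * b"
    unfolding Fk by (simp add: c algebra_simps)
  also have "\<dots> = 2 * F * pderiv b + pderiv F * b"
    by (simp add: c pderiv_mult algebra_simps)
  finally have "of_nat (2 * k + 1) * pderiv F * c + 2 * F * pderiv c = 0"
    using assms(1) by simp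
  then have e: "of_nat (2 * k + 1) * pderiv F * c = F * (- 2 * pderiv c)"
    by (simp add: algebra_simps eq_neg_iff_add_eq_0)
  obtain u v where uv: "u * F + v * pderiv F = 1"
    by (rule bezoutE)
  have "of_nat (2 * k + 1) * c = of_nat (2 * k + 1) * c * (u * F + v * pderiv F)"
    by (simp add: uv)
  also have "\<dots> = F * (of_nat (2 * k + 1) * c * u) + v * (of_nat (2 * k + 1) * pderiv F * c)"
    by (simp only: algebra_simps)
  also have "\<dots> = F * (of_nat (2 * k + 1) * c * u + v * (- 2 * pderiv c))"
    unfolding e by (simp only: algebra_simps)
  finally have "F dvd smult (of_nat (2 * k + 1)) c"
    by (simp add: of_nat_poly)
  then have "F dvd c"
    using assms(3) by (rule dvd_smult_cancel)
  then show ?thesis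
    by (auto simp: c mult.commute intro: mult_dvd_mono)
qed

text \<open>If \<open>F ^ k\<close> divides a nonzero \<open>b\<close>, then
  \<open>3 k \<le> degree b\<close>, which keeps \<open>2 k + 1\<close> below \<open>p\<close>; so
  the divisibility never stops.\<close>

lemma D_mult_Y_eq_0_imp_0:
  assumes "CHAR('a) = p" "2 * degree b + 3 \<le> p" 
    and "2 * F * pderiv b + pderiv F * b = 0"
  shows "b = 0"
proof (rule ccontr)
  assume "b \<noteq> 0"
  have "F ^ k dvd b" for k
  proof (induction k)
    case (Suc k)
    have "degree (F ^ k) \<le> degree b"
      using Suc \<open>b \<noteq> 0\<close> by (rule dvd_imp_degree_le)
    then have "3 * k \<le> degree b"
      by (simp add: degree_power_eq)
    then show ?case
      using assms by (intro F_power_dvd_imp_Suc[OF assms(3) Suc] of_nat_less_CHAR_nonzero) auto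
  qed simp
  then have "degree (F ^ Suc (degree b)) \<le> degree b"
    using \<open>b \<noteq> 0\<close> by (intro dvd_imp_degree_le)
  then show False
    by (simp add: degree_power_eq del: power_Suc)
qed

text \<open>With \<open>g = a + b y\<close> generating the \<open>p\<close>-th power of the ideal of
  \<open>P\<close>, the relation \<open>D g = 2 l g\<close> splits into \<open>a' = l b\<close> and
  \<open>2 F b' + F' b = 2 l a\<close>; eliminating \<open>b\<close> gives the equation for
  \<open>a\<close>.\<close>

lemma torsion_imp_eigenvector:
  assumes p: "CHAR('a) = p" "odd p" "p > 0"
    and "P \<noteq> Infinity" "P \<in> torsion E p"
  shows "\<exists>a l. l \<noteq> 0 \<and> pderiv a \<noteq> 0 \<and>
    2 * F * pderiv (pderiv a) + pderiv F * pderiv a = smult (2 * l ^ 2) a"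
proof -
  obtain x y where P: "P = Affine x y"
    using assms(4) by (cases P) auto
  have on: "on_curve E P" and P1: "gens P ^ p \<approx> 1"
    using assms(5) point_mult_eq_Infinity_iff[of P p] by (auto simp: torsion_def)
  have y: "y ^ 2 = poly F x"
    using on by (simp add: P)
  \<comment> \<open>A point with \<open>y = 0\<close> is its own inverse, and \<open>p\<close> is
    odd.\<close>
  have "y \<noteq> 0"
  proof
    assume "y = 0"
    then have "gens P * gens P \<approx> 1"
      using gens_neg[OF y] by (simp add: P)
    then have "gens P * (gens P ^ 2) ^ (p div 2) \<approx> gens P * 1 ^ (p div 2)"
      by (intro equivalent_times equivalent_refl equivalent_power) (simp add: power2_eq_square)
    also have "gens P * (gens P ^ 2) ^ (p div 2) = gens P ^ p"
      using p(2) by (metis odd_two_times_div_two_succ power_Suc power_mult Suc_eq_plus1)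
    finally have "gens P \<approx> 1"
      using P1 equivalent_sym equivalent_trans by (metis mult.right_neutral power_one)
    then show False
      using gens_not_principal[OF y] P by simp
  qed
  define t where "t = [:-x, 1:]"
  obtain a b c where ab: "rspan (gens P ^ p) = rspan {emb a + emb b * Y}"
    and c: "c \<noteq> 0" and N: "a ^ 2 - F * b ^ 2 = smult c (t ^ p)"
    using principal_power_norm[OF y] P1 unfolding P t_def by metis
  have "degree (a ^ 2 - F * b ^ 2) = p"
    unfolding N using c by (simp add: t_def degree_power_eq)
  \<comment> \<open>As \<open>p\<close> is odd, the degree of the norm comes from
    \<open>F b ^ 2\<close>.\<close>
  then have b0: "b \<noteq> 0" and da: "2 * degree a < p" and db: "2 * degree b + 3 = p"
    using p(2) unfolding degree_norm by (auto split: if_splits simp: max_def) presburger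
  \<comment> \<open>Otherwise \<open>a\<close> and \<open>b\<close> both vanish at \<open>x\<close>,
    and \<open>g\<close> vanishes at \<open>(x, - y)\<close> too; but \<open>(Y - y) ^ p\<close> is
    a multiple of \<open>g\<close> and does not vanish there.\<close>
  have bx: "poly b x \<noteq> 0"
  proof
    assume "poly b x = 0"
    have "poly (a ^ 2 - F * b ^ 2) x = 0"
      unfolding N using p by (simp add: t_def)
    then have "poly a x = 0"
      using \<open>poly b x = 0\<close> by simp
    have "Y - emb [:y:] \<in> gens P"
      by (simp add: P)
    then have "(Y - emb [:y:]) ^ k \<in> rspan (gens P ^ k)" for k
      by (induction k) (auto simp: rspan_base intro: rspan_base rspan_times)
    then have "(Y - emb [:y:]) ^ p \<in> rspan {emb a + emb b * Y}"
      unfolding ab[symmetric] .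
    moreover have y': "(-y) ^ 2 = poly F x"
      using y by (simp del: F_simps)
    moreover have "vanishes x (-y) (emb a + emb b * Y)"
      using \<open>poly a x = 0\<close> \<open>poly b x = 0\<close> by simp
    ultimately have "vanishes x (-y) ((Y - emb [:y:]) ^ p)"
      using vanishes_rspan[of "-y" x "{emb a + emb b * Y}"] RI by blast
    then have "vanishes x (-y) (Y - emb [:y:])"
      by (rule vanishes_power[OF y', rotated]) simp
    then have "2 * y = 0"
      by (simp add: eq_neg_iff_add_eq_0)
    then show False
      using \<open>y \<noteq> 0\<close> two_nonzero by simp
  qed
  define n where "n = smult c (t ^ p)"
  have n: "n = a ^ 2 - F * b ^ 2" "n \<noteq> 0"
    using N c by (simp_all add: n_def t_def)
  have "pderiv n = 0"
    using p(1) by (simp add: n_def pderiv_smult pderiv_power of_nat_eq_0_iff_char_dvd)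
  then have n': "2 * a * pderiv a = pderiv F * b ^ 2 + 2 * F * b * pderiv b"
    unfolding n by (simp add: pderiv_diff pderiv_mult power2_eq_square algebra_simps)
  \<comment> \<open>\<open>V\<close> is the product of \<open>D g\<close> with the conjugate of \<open>g\<close>, where \<open>g = a + b y\<close>.\<close>
  define V where "V = a * (2 * F * pderiv b + pderiv F * b) - 2 * F * pderiv a * b"
  have bV: "b * V = 2 * pderiv a * n"
  proof -
    have "b * V = a * (pderiv F * b ^ 2 + 2 * F * b * pderiv b) - 2 * F * pderiv a * b ^ 2"
      by (simp add: V_def power2_eq_square algebra_simps)
    also have "\<dots> = 2 * pderiv a * n"
      unfolding n'[symmetric] n by (simp add: power2_eq_square algebra_simps)
    finally show ?thesis .
  qed
  have aV: "a * V = (2 * F * pderiv b + pderiv F * b) * n"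
  proof -
    have "a * V = a ^ 2 * (2 * F * pderiv b + pderiv F * b) - F * b * (2 * a * pderiv a)"
      by (simp add: V_def power2_eq_square algebra_simps)
    also have "\<dots> = (2 * F * pderiv b + pderiv F * b) * n"
      unfolding n' n by (simp add: power2_eq_square algebra_simps)
    finally show ?thesis .
  qed
  \<comment> \<open>So \<open>n\<close> divides \<open>V\<close>, and the degree bound leaves a
    constant quotient \<open>V / n = D g / g\<close>, which is named \<open>2 l\<close>.\<close>
  have "t ^ p dvd b * V"
    unfolding bV n_def by (intro dvd_mult dvd_smult) simp
  then have "t ^ p dvd V"
    unfolding t_def using bx by (rule linear_power_dvd_mult_cancel)
  then obtain k where k: "V = t ^ p * k" ..
  have "degree V \<le> p"
  proof -
    have "degree (2 * F * pderiv b) \<le> degree b + 2"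
    proof (cases "pderiv b = 0")
      case False
      then have "degree b \<noteq> 0"
        by (rule pderiv_nonzero_imp_degree)
      have "degree (2 * F * pderiv b) \<le> 0 + 3 + (degree b - 1)"
        by (intro order.trans[OF degree_mult_le] add_mono degree_pderiv_le_pred) auto
      then show ?thesis
        using \<open>degree b \<noteq> 0\<close> by simp
    qed auto
    moreover have "degree (pderiv F * b) \<le> 2 + degree b"
      using degree_pderiv_le_pred[of F] by (intro order.trans[OF degree_mult_le] add_mono) auto
    ultimately have "degree (2 * F * pderiv b + pderiv F * b) \<le> degree b + 2"
      by (intro degree_add_le) auto
    then have "degree (a * (2 * F * pderiv b + pderiv F * b)) \<le> degree a + (degree b + 2)"
      by (intro order.trans[OF degree_mult_le] add_mono) auto
    moreover have "degree (2 * F * pderiv a * b) \<le> degree a + (degree b + 2)"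
    proof (cases "pderiv a = 0")
      case False
      then have "degree a \<noteq> 0"
        by (rule pderiv_nonzero_imp_degree)
      have "degree (2 * F * pderiv a * b) \<le> 0 + 3 + (degree a - 1) + degree b"
        by (intro order.trans[OF degree_mult_le] add_mono degree_pderiv_le_pred) auto
      then show ?thesis
        using \<open>degree a \<noteq> 0\<close> by simp
    qed auto
    ultimately have "degree V \<le> degree a + (degree b + 2)"
      unfolding V_def by (intro degree_diff_le)
    then show ?thesis
      using da db by linarith
  qed
  have "degree k = 0"
  proof (cases "k = 0")
    case False
    then have "degree V = p + degree k"
      by (simp add: k t_def degree_mult_eq degree_power_eq)
    then show ?thesis
      using \<open>degree V \<le> p\<close> by simp
  qed simp
  then obtain k' where "k = [:k':]"
    by (metis degree_eq_zeroE)
  define l where "l = k' / (2 * c)"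
  have V: "V = smult (2 * l) n"
    using c two_nonzero by (simp add: k \<open>k = [:k':]\<close> l_def n_def)
  have two_poly: "smult (2 * r) q = 2 * smult r q" for r and q :: "'a poly"
    by (simp add: numeral_poly mult.commute)
  have two_poly_nz: "(2 :: 'a poly) \<noteq> 0"
    using two_nonzero by (metis degree_0 numeral_poly pCons_eq_0_iff)
  have "2 * (smult l b * n) = 2 * (pderiv a * n)"
    using bV unfolding V two_poly by (simp add: mult_ac)
  then have a': "pderiv a = smult l b"
    using n(2) two_poly_nz by (metis mult_cancel_left mult_cancel_right)
  have "smult (2 * l) a * n = (2 * F * pderiv b + pderiv F * b) * n"
    using aV unfolding V by (simp add: mult_ac)
  then have b': "2 * F * pderiv b + pderiv F * b = smult (2 * l) a"
    using n(2) by (metis mult_cancel_right)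
  have l0: "l \<noteq> 0"
  proof
    assume "l = 0"
    then show False
      using D_mult_Y_eq_0_imp_0[OF p(1), of b] b' b0 db by simp
  qed
  have "2 * F * pderiv (pderiv a) + pderiv F * pderiv a = smult l (2 * F * pderiv b + pderiv F * b)"
    unfolding a' pderiv_smult by (simp add: smult_add_right algebra_simps)
  also have "\<dots> = smult (2 * l ^ 2) a"
    unfolding b' by (simp add: power2_eq_square mult_ac)
  finally show ?thesis
    using l0 b0 a' by (intro exI[of _ a] exI[of _ l]) auto
qed

end

section \<open>Points of order p from functions of prescribed norm, and uniqueness of the eigenvalue\<close>

text \<open>The inverse is improved one power at a time: \<open>c\<close> is chosen so that the
  error \<open>q - b c\<close> vanishes at \<open>x\<close>.\<close>

lemma inverse_mod_linear_power:
  fixes b :: "'a::field poly"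
  assumes "poly b x \<noteq> 0"
  obtains s q where "b * s = 1 + [:-x, 1:] ^ n * q"
proof (induction n arbitrary: thesis)
  case 0
  then show ?case
    using 0[of 0 "-1"] by simp
next
  case (Suc n)
  from Suc.IH obtain s q where IH: "b * s = 1 + [:-x, 1:] ^ n * q" .
  define c where "c = poly q x / poly b x"
  have "poly (q - b * [:c:]) x = 0"
    using assms by (simp add: c_def)
  then obtain r where r: "q - b * [:c:] = [:-x, 1:] * r"
    unfolding poly_eq_0_iff_dvd dvd_def by blast
  have "b * (s - [:-x, 1:] ^ n * [:c:]) = 1 + [:-x, 1:] ^ n * (q - b * [:c:])"
    using IH by (simp add: algebra_simps)
  also have "\<dots> = 1 + [:-x, 1:] ^ Suc n * r"
    unfolding r by (simp only: power_Suc mult_ac)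
  finally show ?case
    by (rule Suc.prems)
qed

section \<open>Powers of the ideal of a point\<close>

context cubic
begin

lemma linear_sq_not_dvd_F: "\<not> [:-x, 1:] ^ 2 dvd F"
proof
  assume "[:-x, 1:] ^ 2 dvd F"
  then obtain k where k: "F = [:-x, 1:] ^ 2 * k" ..
  then have F: "poly F x = 0"
    by simp
  have "poly (pderiv F) x = 0"
    unfolding k by (simp add: pderiv_mult pderiv_power)
  moreover obtain u v where "u * F + v * pderiv F = 1"
    by (rule bezoutE)
  ultimately have "poly (1 :: 'a poly) x = 0"
    using F by (metis add_0 mult_zero_right poly_add poly_mult)
  then show False
    by simp
qed

text \<open>
  Mumford's representation of a multiple of the point: \<open>v\<close> is a square root of \<open>F\<close> modulo
  \<open>(X - x) ^ n\<close>.
\<close>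

lemma rspan_gens_power:
  assumes F: "F - v ^ 2 = [:-x, 1:] ^ n * k" and "poly v x \<noteq> 0" and "1 \<le> j" "j \<le> n"
  shows "rspan (gens (Affine x (poly v x)) ^ j) = rspan {emb ([:-x, 1:] ^ j), Y - emb v}"
  using assms(3,4)
proof (induction j rule: dec_induct)
  case base
  show ?case
    using rspan_gens[of v x "poly v x"] by (simp del: gens.simps set_one)
next
  case (step j)
  define t where "t = [:-x, 1:]"
  define l where "l = Y - emb v"
  have lR [simp]: "l \<in> R"
    by (simp add: l_def)
  let ?S = "{emb t, l} * {emb (t ^ j), l}"
  have "rspan (gens (Affine x (poly v x)) * gens (Affine x (poly v x)) ^ j) = rspan ?S"
    unfolding t_def l_def using step by (intro rspan_times_cong rspan_gens refl) simp
  also have "\<dots> = rspan {emb (t ^ Suc j), l}"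
  proof (rule rspan_eqI)
    fix s assume "s \<in> ?S"
    then consider "s = 1 * emb (t ^ Suc j)" | "s = emb t * l" | "s = emb (t ^ j) * l" | "s = l * l"
      by (auto elim!: set_times_elim simp: mult.commute)
    then show "s \<in> rspan {emb (t ^ Suc j), l}"
      by cases (hypsubst, intro rspan_mult_base; simp)+
  next
    have mem: "a * b \<in> rspan ?S" if "a \<in> {emb t, l}" "b \<in> {emb (t ^ j), l}" for a b
      using that by (intro rspan_base set_times_intro)
    obtain m where m: "n = j + 1 + m"
      using step by (auto simp: le_iff_add)
    \<comment> \<open>The identity \<open>(F - v ^ 2) - l ^ 2 = 2 v l\<close> puts
      \<open>2 v l\<close> into the ideal. As \<open>2 v\<close> is invertible modulo
      \<open>t\<close> and \<open>t l\<close> is in the ideal, so is \<open>l\<close>.\<close>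
    have "poly (2 * v) x \<noteq> 0"
      using assms(2) two_nonzero by simp
    from inverse_mod_linear_power[OF this, of 1] obtain s q where sq: "2 * v * s = 1 + t * q"
      by (auto simp: t_def)
    have tt: "emb t * emb (t ^ j) \<in> rspan ?S" and tl: "emb t * l \<in> rspan ?S" and ll: "l * l \<in> rspan ?S"
      by (intro mem; simp)+
    have "F - v * v = t ^ m * k * (t * t ^ j)"
      using F unfolding m t_def[symmetric] by (simp add: power_add power2_eq_square mult_ac)
    then have "emb (F - v * v) = emb (t ^ m * k) * (emb t * emb (t ^ j))"
      by simp
    moreover have "emb (F - v * v) - 1 * (l * l) = emb (2 * v) * l"
      unfolding emb_simps Y_mult_Y[symmetric] by (simp add: l_def algebra_simps)
    ultimately have vl: "emb (2 * v) * l \<in> rspan ?S"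
      using rspan_diff[OF rspan_mult[OF tt, of "emb (t ^ m * k)"] ll] by simp
    have "emb s * (emb (2 * v) * l) - emb q * (emb t * l) \<in> rspan ?S"
      by (rule rspan_diff[OF rspan_mult[OF vl emb_R] rspan_mult[OF tl emb_R]])
    also have "emb s * (emb (2 * v) * l) - emb q * (emb t * l) = emb (2 * v * s - t * q) * l"
      by (simp add: algebra_simps)
    also have "\<dots> = l"
      by (simp add: sq)
    finally have "l \<in> rspan ?S" .
    then show "s \<in> rspan ?S" if "s \<in> {emb (t ^ Suc j), l}" for s
      using that tt by auto
  qed
  finally show ?case
    by (simp add: t_def l_def del: gens.simps)
qed

text \<open>Converse of \<open>principal_power_norm\<close>. Solving \<open>a + b v = 0\<close>
  modulo \<open>t ^ n\<close> gives a square root \<open>v\<close> of \<open>F\<close> modulo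
  \<open>t ^ n\<close>, and then \<open>t ^ n\<close> and \<open>Y - v\<close> generate the same
  ideal as \<open>a + b Y\<close>.\<close>

lemma norm_power_imp_principal:
  assumes N: "a ^ 2 - F * b ^ 2 = smult c ([:-x, 1:] ^ n)" and "c \<noteq> 0" "2 \<le> n"
    and prim: "poly a x \<noteq> 0 \<or> poly b x \<noteq> 0"
  shows "\<exists>y. on_curve E (Affine x y) \<and> gens (Affine x y) ^ n \<approx> 1"
proof -
  define t where "t = [:-x, 1:]"
  have N0: "poly a x ^ 2 = poly F x * poly b x ^ 2"
    using arg_cong[OF N, of "\<lambda>q. poly q x"] assms(3) by (simp add: power_0_left del: F_simps)
  then have b0: "poly b x \<noteq> 0"
    using prim by auto
  define y where "y = - poly a x / poly b x"
  have on: "on_curve E (Affine x y)"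
    unfolding on_curve_iff using N0 b0 by (simp add: y_def power_divide del: F_simps)
  \<comment> \<open>If \<open>a\<close> vanished at \<open>x\<close>, then \<open>t ^ 2\<close>
    would divide \<open>b ^ 2 F\<close>, although \<open>b\<close> does not vanish at
    \<open>x\<close> and \<open>F\<close> is squarefree. This gives
    \<open>y \<noteq> 0\<close>.\<close>
  have a0: "poly a x \<noteq> 0"
  proof
    assume "poly a x = 0"
    then have "t ^ 2 dvd a ^ 2"
      by (intro dvd_power_same) (simp add: t_def poly_eq_0_iff_dvd)
    moreover have "t ^ 2 dvd smult c (t ^ n)"
      using assms(3) by (intro dvd_smult le_imp_power_dvd)
    ultimately have "t ^ 2 dvd a ^ 2 - smult c (t ^ n)"
      by (rule dvd_diff)
    also have "a ^ 2 - smult c (t ^ n) = b ^ 2 * F"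
      using N by (simp add: t_def algebra_simps)
    finally have "t ^ 2 dvd F"
      unfolding t_def by (rule linear_power_dvd_mult_cancel) (use b0 in simp)
    then show False
      unfolding t_def using linear_sq_not_dvd_F by blast
  qed
  from inverse_mod_linear_power[OF b0, of n] obtain s q where sq: "b * s = 1 + t ^ n * q"
    by (auto simp: t_def)
  define v where "v = - (a * s)"
  have "poly b x * poly s x = 1"
    using arg_cong[OF sq, of "\<lambda>q. poly q x"] assms(3) by (simp add: t_def)
  then have vx: "poly v x = y"
    using b0 by (simp add: v_def y_def field_simps)
  have "F - v ^ 2 = F * (1 - (b * s) ^ 2) - s ^ 2 * (a ^ 2 - F * b ^ 2)"
    by (simp add: v_def algebra_simps power_mult_distrib)
  also have "\<dots> = t ^ n * (F * (- q * (2 + t ^ n * q)) - smult c (s ^ 2))"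
    unfolding sq N t_def[symmetric] by (simp add: algebra_simps power2_eq_square)
  finally have Fv: "F - v ^ 2 = [:-x, 1:] ^ n * (F * (- q * (2 + t ^ n * q)) - smult c (s ^ 2))"
    by (simp add: t_def)
  have "y \<noteq> 0"
    using a0 b0 by (simp add: y_def)
  define g where "g = emb a + emb b * Y"
  have "rspan (gens (Affine x y) ^ n) = rspan {emb (t ^ n), Y - emb v}"
    using rspan_gens_power[OF Fv, of n] \<open>y \<noteq> 0\<close> assms(3) unfolding vx t_def by simp
  also have "\<dots> = rspan {g}"
  proof (rule rspan_eqI)
    have gg: "emb [:1 / c:] * ((emb a - emb b * Y) * g) = emb (t ^ n)"
    proof -
      have "(emb a - emb b * Y) * g = (emb a + emb (-b) * Y) * (emb a + emb b * Y)"
        by (simp add: g_def)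
      also have "\<dots> = emb (smult c (t ^ n))"
        unfolding mult_emb_Y t_def N[symmetric] by (simp add: algebra_simps power2_eq_square)
      finally have "emb [:1 / c:] * ((emb a - emb b * Y) * g) = emb ([:1 / c:] * smult c (t ^ n))"
        by (simp only: emb_simps)
      also have "[:1 / c:] * smult c (t ^ n) = t ^ n"
        using assms(2) by simp
      finally show ?thesis .
    qed
    have tn: "emb (t ^ n) \<in> rspan {g}"
      unfolding gg[symmetric] by (intro rspan_mult rspan_base) auto
    have "Y - emb v = emb s * g - (emb q * Y) * emb (t ^ n)"
    proof -
      have "emb s * g = emb (s * a) + emb (b * s) * Y"
        by (simp add: g_def algebra_simps)
      then show ?thesis
        unfolding sq by (simp add: v_def algebra_simps)
    qed
    also have "\<dots> \<in> rspan {g}"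
      using rspan_diff[OF rspan_mult_base rspan_mult[OF tn]] by simp
    finally show "r \<in> rspan {g}" if "r \<in> {emb (t ^ n), Y - emb v}" for r
      using that tn by blast
    have "a + b * v = a * (1 - b * s)"
      by (simp add: v_def algebra_simps)
    also have "\<dots> = - (a * q) * t ^ n"
      unfolding sq by (simp add: algebra_simps)
    finally have abv: "emb a + emb b * emb v = emb (- (a * q)) * emb (t ^ n)"
      by (metis emb_simps(3,6))
    have "g = emb b * (Y - emb v) + (emb a + emb b * emb v)"
      by (simp add: g_def algebra_simps)
    also have "\<dots> = emb b * (Y - emb v) + emb (- (a * q)) * emb (t ^ n)"
      unfolding abv ..
    also have "\<dots> \<in> rspan {emb (t ^ n), Y - emb v}"
      by (intro rspan_add rspan_mult_base) auto
    finally show "r \<in> rspan {emb (t ^ n), Y - emb v}" if "r \<in> {g}" for r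
      using that by blast
  qed
  finally have "rspan (gens (Affine x y) ^ n) = rspan {g}" .
  moreover have "g \<noteq> 0"
    using b0 unfolding g_def emb_Y_eq_0_iff by auto
  ultimately show ?thesis
    using on unfolding equivalent_1_iff by blast
qed

end

section \<open>Iterated derivations in characteristic p\<close>

lemma derivation_of_nat_mult:
  fixes d :: "'b::comm_ring_1 \<Rightarrow> 'b"
  assumes "\<And>x y. d (x + y) = d x + d y"
  shows "d (of_nat k * x) = of_nat k * d x"
proof (induction k)
  case 0
  show ?case
    using assms[of 0 0] by simp
qed (simp add: assms algebra_simps)

lemma derivation_funpow_mult:
  fixes d :: "'b::comm_ring_1 \<Rightarrow> 'b"
  assumes add: "\<And>x y. d (x + y) = d x + d y" and mult: "\<And>x y. d (x * y) = d x * y + x * d y"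
  shows "(d ^^ n) (x * y) = (\<Sum>i\<le>n. of_nat (n choose i) * ((d ^^ i) x * (d ^^ (n - i)) y))"
proof (induction n)
  case (Suc n)
  let ?X = "\<lambda>i. (d ^^ i) x" and ?Y = "\<lambda>i. (d ^^ i) y"
  have d0: "d 0 = 0"
    using add[of 0 0] by simp
  have dsum: "d (sum f I) = (\<Sum>i\<in>I. d (f i))" for f :: "nat \<Rightarrow> 'b" and I
    by (induction I rule: infinite_finite_induct) (simp_all add: d0 add)
  have dn: "d (of_nat k * (u * v)) = of_nat k * (d u * v + u * d v)" for k u v
    by (subst derivation_of_nat_mult[of d, OF add]) (simp only: mult)
  have "(d ^^ Suc n) (x * y) = (\<Sum>i\<le>n. of_nat (n choose i) * (?X (Suc i) * ?Y (n - i)))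
     + (\<Sum>i\<le>n. of_nat (n choose i) * (?X i * ?Y (Suc n - i)))"
    by (simp add: Suc dsum dn distrib_left sum.distrib Suc_diff_le)
  also have "(\<Sum>i\<le>n. of_nat (n choose i) * (?X i * ?Y (Suc n - i)))
     = (\<Sum>i\<le>Suc n. of_nat (n choose i) * (?X i * ?Y (Suc n - i)))"
    by (simp add: binomial_eq_0)
  also have "\<dots> = x * ?Y (Suc n) + (\<Sum>i\<le>n. of_nat (n choose Suc i) * (?X (Suc i) * ?Y (n - i)))"
    unfolding sum.atMost_Suc_shift by simp
  also have "(\<Sum>i\<le>n. of_nat (n choose i) * (?X (Suc i) * ?Y (n - i))) + \<dots>
     = x * ?Y (Suc n) + (\<Sum>i\<le>n. of_nat (Suc n choose Suc i) * (?X (Suc i) * ?Y (n - i)))"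
    by (simp add: algebra_simps flip: sum.distrib)
  also have "\<dots> = (\<Sum>i\<le>Suc n. of_nat (Suc n choose i) * (?X i * ?Y (Suc n - i)))"
    unfolding sum.atMost_Suc_shift by simp
  finally show ?case .
qed simp

text \<open>The inner binomial coefficients in Leibniz's formula are divisible by
  \<open>p\<close>.\<close>

lemma derivation_funpow_CHAR:
  fixes d :: "'b::comm_ring_1 \<Rightarrow> 'b"
  assumes add: "\<And>x y. d (x + y) = d x + d y" and mult: "\<And>x y. d (x * y) = d x * y + x * d y"
    and p: "prime p" "CHAR('b) = p"
  shows "(d ^^ p) (x * y) = (d ^^ p) x * y + x * (d ^^ p) y"
proof -
  let ?f = "\<lambda>i. of_nat (p choose i) * ((d ^^ i) x * (d ^^ (p - i)) y)"
  have p0: "0 < p"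
    using p(1) by (rule prime_gt_0_nat)
  have "(d ^^ p) (x * y) = (\<Sum>i\<le>p. ?f i)"
    by (rule derivation_funpow_mult[OF add mult])
  also have "\<dots> = (\<Sum>i\<in>{0, p}. ?f i)"
  proof (rule sum.mono_neutral_right)
    show "\<forall>i\<in>{..p} - {0, p}. ?f i = 0"
    proof
      fix i assume "i \<in> {..p} - {0, p}"
      then have "p dvd p choose i"
        using p(1) by (intro dvd_choose_prime) auto
      then have "of_nat (p choose i) = (0 :: 'b)"
        using p(2) by (simp add: of_nat_eq_0_iff_char_dvd)
      then show "?f i = 0"
        by simp
    qed
  qed auto
  also have "\<dots> = (d ^^ p) x * y + x * (d ^^ p) y"
    using p0 by simp
  finally show ?thesis .
qed

context cubic
begin

text \<open>
  The lift of \<open>D\<close> to the polynomial ring \<open>K[x][y]\<close>, which is a type. It annihilates the equation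
  of the curve, so that it may be iterated modulo this equation.
\<close>

definition deriv_xy :: "'a poly poly \<Rightarrow> 'a poly poly" where
  "deriv_xy G = [:0, 2:] * map_poly pderiv G + smult (pderiv F) (pderiv G)"

lemma map_poly_pderiv_add: "map_poly pderiv (G + H) = map_poly pderiv G + map_poly pderiv (H :: 'a poly poly)"
  by (rule poly_eqI) (simp add: coeff_map_poly pderiv_add)

lemma map_poly_pderiv_smult:
  "map_poly pderiv (smult c G) = smult (pderiv c) G + smult c (map_poly pderiv (G :: 'a poly poly))"
  by (rule poly_eqI) (simp add: coeff_map_poly pderiv_mult algebra_simps)

lemma map_poly_pderiv_mult:
  "map_poly pderiv (G * H) = map_poly pderiv G * H + G * map_poly pderiv (H :: 'a poly poly)"
proof (induction G)
  case (pCons c G)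
  then show ?case
    by (simp add: map_poly_pCons map_poly_pderiv_add map_poly_pderiv_smult)
qed simp

lemma deriv_xy_add: "deriv_xy (G + H) = deriv_xy G + deriv_xy H"
  by (simp add: deriv_xy_def map_poly_pderiv_add pderiv_add smult_add_right algebra_simps)

lemma deriv_xy_mult: "deriv_xy (G * H) = deriv_xy G * H + G * deriv_xy H"
  by (simp add: deriv_xy_def map_poly_pderiv_mult pderiv_mult smult_add_right algebra_simps)

lemma deriv_xy_const: "deriv_xy [:a:] = [:0, 2 * pderiv a:]"
  by (simp add: deriv_xy_def map_poly_pCons pderiv_pCons)

definition eqn :: "'a poly poly" where "eqn = [:- F, 0, 1:]"

lemma deriv_xy_eqn: "deriv_xy eqn = 0"
  by (simp add: deriv_xy_def eqn_def map_poly_pCons pderiv_pCons pderiv_minus)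

lemma deriv_xy_funpow_dvd: "eqn dvd G \<Longrightarrow> eqn dvd (deriv_xy ^^ n) G"
proof (induction n)
  case (Suc n)
  then obtain H where "(deriv_xy ^^ n) G = eqn * H"
    by auto
  then show ?case
    by (simp add: deriv_xy_mult deriv_xy_eqn)
qed simp

lemma deriv_xy_0: "deriv_xy 0 = 0"
  by (simp add: deriv_xy_def)

lemma deriv_xy_funpow_add: "(deriv_xy ^^ n) (G + H) = (deriv_xy ^^ n) G + (deriv_xy ^^ n) H"
  by (induction n) (simp_all add: deriv_xy_add)

text \<open>The \<open>p\<close>-th iterate is a derivation that kills constants, so on
  \<open>K[x]\<close> it is determined by its value at \<open>x\<close>.\<close>

lemma deriv_xy_funpow_const:
  assumes p: "prime p" "CHAR('a) = p"
  shows "(deriv_xy ^^ p) [:a:] = [:pderiv a:] * (deriv_xy ^^ p) [:[:0, 1:]:]"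
proof (induction a)
  case 0
  have "(deriv_xy ^^ p) 0 = 0"
    by (induction p) (simp_all add: deriv_xy_0)
  then show ?case
    by simp
next
  case (pCons c a)
  have 0: "(deriv_xy ^^ n) 0 = 0" for n
    by (induction n) (simp_all add: deriv_xy_0)
  obtain n where n: "p = Suc n"
    using prime_gt_0_nat[OF p(1)] gr0_implies_Suc by blast
  have c: "(deriv_xy ^^ p) [:[:c:]:] = 0"
    unfolding n funpow_Suc_right by (simp add: deriv_xy_const pderiv_pCons 0)
  have "[:pCons c a:] = [:[:c:]:] + [:[:0, 1:]:] * [:a:]"
    by simp
  then have "(deriv_xy ^^ p) [:pCons c a:] = (deriv_xy ^^ p) ([:[:0, 1:]:] * [:a:])"
    by (simp only: deriv_xy_funpow_add c add_0)
  also have "\<dots> = (deriv_xy ^^ p) [:[:0, 1:]:] * [:a:] + [:[:0, 1:]:] * (deriv_xy ^^ p) [:a:]"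
    by (rule derivation_funpow_CHAR[OF deriv_xy_add deriv_xy_mult]) (use p in simp_all)
  also have "\<dots> = [:pderiv (pCons c a):] * (deriv_xy ^^ p) [:[:0, 1:]:]"
    unfolding pCons.IH by (simp add: pderiv_pCons smult_add_left algebra_simps)
  finally show ?case .
qed

text \<open>Modulo the curve, \<open>D (D a) = 4 F a'' + 2 F' a'\<close>, so \<open>a\<close> is an
  eigenvector of \<open>D ^ 2\<close> with eigenvalue \<open>2 \<nu>\<close>.\<close>

lemma deriv_xy_eigenvector:
  assumes "2 * F * pderiv (pderiv a) + pderiv F * pderiv a = smult \<nu> a"
  shows "eqn dvd (deriv_xy ^^ (2 * j)) [:a:] - [:smult ((2 * \<nu>) ^ j) a:]"
proof (induction j)
  case (Suc j)
  define G where "G = (deriv_xy ^^ (2 * j)) [:a:] - [:smult ((2 * \<nu>) ^ j) a:]"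
  have "(deriv_xy ^^ (2 * Suc j)) [:a:] = deriv_xy (deriv_xy (G + [:smult ((2 * \<nu>) ^ j) a:]))"
    by (simp add: G_def)
  also have "\<dots> = (deriv_xy ^^ 2) G + deriv_xy (deriv_xy [:smult ((2 * \<nu>) ^ j) a:])"
    by (simp add: deriv_xy_add numeral_2_eq_2)
  also have "deriv_xy (deriv_xy [:smult ((2 * \<nu>) ^ j) a:])
     = smult [:(2 * \<nu>) ^ j:] (deriv_xy (deriv_xy [:a:]))"
    by (simp add: deriv_xy_const deriv_xy_def map_poly_pCons pderiv_pCons pderiv_smult pderiv_mult)
  also have "deriv_xy (deriv_xy [:a:])
     = [:4 * pderiv (pderiv a):] * eqn + [:2 * (2 * F * pderiv (pderiv a) + pderiv F * pderiv a):]"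
    by (simp add: deriv_xy_const deriv_xy_def eqn_def map_poly_pCons pderiv_pCons pderiv_mult algebra_simps)
  finally have "(deriv_xy ^^ (2 * Suc j)) [:a:] - [:smult ((2 * \<nu>) ^ Suc j) a:]
     = (deriv_xy ^^ 2) G + smult [:(2 * \<nu>) ^ j:] ([:4 * pderiv (pderiv a):] * eqn)"
    unfolding assms by (simp add: smult_add_right numeral_poly mult_ac)
  moreover have "eqn dvd (deriv_xy ^^ 2) G"
    using Suc unfolding G_def by (rule deriv_xy_funpow_dvd)
  ultimately show ?case
    by (simp add: dvd_smult)
qed simp

text \<open>\<open>D ^ p a\<close> is computed twice modulo the curve: as \<open>a' \<Phi>\<close>
  with \<open>\<Phi> = D ^ p x\<close>, and as
  \<open>D (D ^ (2 m) a) = 2 (2 \<mu>) ^ m a' y\<close>. But \<open>\<Phi>\<close> does not depend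
  on \<open>a\<close>.\<close>

theorem eigenvalue_unique:
  assumes p: "prime p" "CHAR('a) = p" "p = 2 * m + 1"
    and a: "2 * F * pderiv (pderiv a) + pderiv F * pderiv a = smult \<mu> a" "pderiv a \<noteq> 0"
    and b: "2 * F * pderiv (pderiv b) + pderiv F * pderiv b = smult \<nu> b" "pderiv b \<noteq> 0"
  shows "\<mu> ^ m = \<nu> ^ m"
proof -
  define \<Phi> where "\<Phi> = (deriv_xy ^^ p) [:[:0, 1:]:]"
  have *: "eqn dvd [:pderiv a:] * (\<Phi> - [:0, [:2 * (2 * \<mu>) ^ m:]:])"
    if "2 * F * pderiv (pderiv a) + pderiv F * pderiv a = smult \<mu> a" for a \<mu>
  proof -
    define G where "G = (deriv_xy ^^ (2 * m)) [:a:] - [:smult ((2 * \<mu>) ^ m) a:]"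
    have "eqn dvd (deriv_xy ^^ 1) G"
      unfolding G_def using that by (intro deriv_xy_funpow_dvd deriv_xy_eigenvector)
    moreover have "(deriv_xy ^^ p) [:a:] = deriv_xy (G + [:smult ((2 * \<mu>) ^ m) a:])"
      by (simp add: G_def p(3))
    ultimately have "eqn dvd (deriv_xy ^^ p) [:a:] - [:0, 2 * smult ((2 * \<mu>) ^ m) (pderiv a):]"
      by (simp add: deriv_xy_add deriv_xy_const pderiv_smult)
    also have "(deriv_xy ^^ p) [:a:] - [:0, 2 * smult ((2 * \<mu>) ^ m) (pderiv a):]
       = [:pderiv a:] * (\<Phi> - [:0, [:2 * (2 * \<mu>) ^ m:]:])"
      unfolding deriv_xy_funpow_const[OF p(1,2), of a] \<Phi>_def[symmetric]
      by (simp add: smult_diff_right numeral_poly mult_ac)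
    finally show ?thesis .
  qed
  define c where "c = 2 * (2 * \<nu>) ^ m - 2 * (2 * \<mu>) ^ m"
  \<comment> \<open>Cross-multiplying by the derivatives eliminates \<open>\<Phi>\<close>; what
    remains has degree at most 1 in \<open>y\<close>, less than \<open>eqn\<close>, and must
    vanish.\<close>
  define G where "G = [:0, smult c (pderiv a * pderiv b):]"
  have "eqn dvd [:pderiv b:] * ([:pderiv a:] * (\<Phi> - [:0, [:2 * (2 * \<mu>) ^ m:]:]))
     - [:pderiv a:] * ([:pderiv b:] * (\<Phi> - [:0, [:2 * (2 * \<nu>) ^ m:]:]))"
    using a b by (intro dvd_diff dvd_mult *)
  also have "\<dots> = G"
    by (simp add: G_def c_def algebra_simps smult_diff_left smult_diff_right)
  finally have "eqn dvd G" .
  have "G = 0"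
  proof (rule ccontr)
    assume "G \<noteq> 0"
    then have "degree eqn \<le> degree G"
      using \<open>eqn dvd G\<close> by (intro dvd_imp_degree_le)
    also have "degree G \<le> 1"
      by (simp add: G_def)
    finally show False
      by (simp add: eqn_def)
  qed
  then have "c = 0"
    using a b by (simp add: G_def)
  then have "2 * (2 ^ m * (\<mu> ^ m)) = 2 * (2 ^ m * \<nu> ^ m)"
    by (auto simp: c_def power_mult_distrib)
  then show ?thesis
    using two_nonzero by simp
qed

end

section \<open>Eigenpolynomials over an algebraically closed field\<close>

text \<open>Each step multiplies by a factor of degree 1, and the \<open>w\<close> term has lower
  degree. It is applied with \<open>z\<close> the eigenvalue and with \<open>z\<close> the parameter
  of the family.\<close>

lemma three_term_recurrence_poly:
  fixes c :: "'a::field \<Rightarrow> nat \<Rightarrow> 'a"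
  assumes "\<And>z. c z 0 = 1" "\<And>z. c z (Suc 0) = u 0 * z + v 0"
    and "\<And>z j. c z (Suc (Suc j)) = (u (Suc j) * z + v (Suc j)) * c z (Suc j) + w j * c z j"
    and "\<And>j. j < n \<Longrightarrow> u j \<noteq> 0"
  shows "\<exists>P. degree P = n \<and> P \<noteq> 0 \<and> (\<forall>z. poly P z = c z n)"
  using assms(4)
proof (induction n rule: less_induct)
  case (less n)
  consider "n = 0" | "n = 1" | j where "n = Suc (Suc j)"
    by (metis One_nat_def not0_implies_Suc)
  then show ?case
  proof cases
    case 1
    then show ?thesis
      using assms(1) by (intro exI[of _ 1]) auto
  next
    case 2
    then show ?thesis
      using assms(2) less.prems[of 0] by (intro exI[of _ "[:v 0, u 0:]"]) auto
  next
    case 3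
    obtain P Q where P: "degree P = Suc j" "\<forall>z. poly P z = c z (Suc j)"
      and Q: "degree Q = j" "\<forall>z. poly Q z = c z j"
      using less.IH[of "Suc j"] less.IH[of j] less.prems 3 by auto
    have u: "u (Suc j) \<noteq> 0"
      using less.prems 3 by simp
    have d1: "degree ([:v (Suc j), u (Suc j):] * P) = n"
      using u P 3 by (subst degree_mult_eq) auto
    then have "degree ([:v (Suc j), u (Suc j):] * P + smult (w j) Q) = n"
      using Q 3 degree_smult_le[of "w j" Q] by (subst degree_add_eq_left) auto
    moreover from this have "[:v (Suc j), u (Suc j):] * P + smult (w j) Q \<noteq> 0"
      using 3 by auto
    moreover have "poly ([:v (Suc j), u (Suc j):] * P + smult (w j) Q) z = c z n" for z
      unfolding 3 assms(3) using P Q by (simp add: algebra_simps)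
    ultimately show ?thesis
      by blast
  qed
qed

text \<open>
  For \<open>F = x\<^sup>3 + A x\<^sup>2 + B x\<close>, comparing coefficients of \<open>x ^ (k + 1)\<close> in \<open>2 F a'' + F' a' = \<nu> a\<close> gives
  \<open>k (2 k + 1) a\<^sub>k + 2 A (k + 1)\<^sup>2 a\<^sub>k\<^sub>+\<^sub>1 + B (k + 2) (2 k + 3) a\<^sub>k\<^sub>+\<^sub>2 = \<nu> a\<^sub>k\<^sub>+\<^sub>1\<close>.
  Below, \<open>eigen_coef A B m \<nu> j\<close> is the solution \<open>a\<^sub>k\<close> at \<open>k = m - j\<close> with \<open>a\<^sub>m = 1\<close>. At \<open>k = 0\<close> the
  factor \<open>k (2 k + 1)\<close> vanishes and is replaced by 1, so that the value at \<open>j = m\<close> is not a coefficient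
  but the obstruction that has to vanish for \<open>\<nu>\<close> to be an eigenvalue.
\<close>

definition lead_coef :: "nat \<Rightarrow> 'a::field" where
  "lead_coef k = (if k = 0 then 1 else of_nat (k * (2 * k + 1)))"

fun eigen_coef :: "'a::field \<Rightarrow> 'a \<Rightarrow> nat \<Rightarrow> 'a \<Rightarrow> nat \<Rightarrow> 'a" where
  "eigen_coef A B m \<nu> 0 = 1"
| "eigen_coef A B m \<nu> (Suc 0) = (\<nu> - 2 * A * of_nat (m ^ 2)) / lead_coef (m - 1)"
| "eigen_coef A B m \<nu> (Suc (Suc j)) =
     ((\<nu> - 2 * A * of_nat ((m - 1 - j) ^ 2)) * eigen_coef A B m \<nu> (Suc j)
      - B * of_nat ((m - j) * (2 * (m - j) - 1)) * eigen_coef A B m \<nu> j) / lead_coef (m - 2 - j)"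

lemma lead_coef_nonzero:
  assumes "prime p" "CHAR('a::field) = p" "2 * k + 1 < p"
  shows "lead_coef k \<noteq> (0 :: 'a)"
proof -
  have "k \<noteq> 0 \<Longrightarrow> of_nat k \<noteq> (0 :: 'a)" "of_nat (2 * k + 1) \<noteq> (0 :: 'a)"
    using assms by (intro of_nat_less_CHAR_nonzero[of p]; simp)+
  then show ?thesis
    unfolding lead_coef_def of_nat_mult by simp
qed

context
  fixes p m :: nat
  assumes p: "prime p" "CHAR('a::field) = p" "p = 2 * m + 1"
begin

text \<open>The degree \<open>m\<close> provides a root \<open>\<nu>\<close> over an algebraically
  closed field once \<open>m > 0\<close>; a nonzero root will be an eigenvalue.\<close>

lemma eigen_coef_poly_eigenvalue:
  "\<exists>P. degree P = m \<and> P \<noteq> 0 \<and> (\<forall>\<nu>. poly P \<nu> = eigen_coef (A :: 'a) B m \<nu> m)"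
proof -
  define u where "u j = (1 / lead_coef (m - 1 - j) :: 'a)" for j
  define v where "v j = (- (2 * A * of_nat ((m - j) ^ 2)) / lead_coef (m - 1 - j) :: 'a)" for j
  define w where "w j = (- (B * of_nat ((m - j) * (2 * (m - j) - 1))) / lead_coef (m - 2 - j) :: 'a)" for j
  show ?thesis
  proof (rule three_term_recurrence_poly[of "eigen_coef A B m" u v w m])
    show "eigen_coef A B m \<nu> (Suc 0) = u 0 * \<nu> + v 0" for \<nu>
      by (simp add: u_def v_def diff_divide_distrib)
    show "eigen_coef A B m \<nu> (Suc (Suc j))
      = (u (Suc j) * \<nu> + v (Suc j)) * eigen_coef A B m \<nu> (Suc j) + w j * eigen_coef A B m \<nu> j" for \<nu> j
    proof -
      have "m - 1 - Suc j = m - 2 - j" "m - Suc j = m - 1 - j"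
        by simp_all
      then show ?thesis
        unfolding eigen_coef.simps u_def v_def w_def
        by (simp only: diff_divide_distrib left_diff_distrib minus_divide_left[symmetric]
            times_divide_eq_left mult_1 ring_distribs diff_conv_add_uminus mult_minus_left add_divide_distrib)
    qed
    show "u j \<noteq> 0" if "j < m" for j
      using lead_coef_nonzero[OF p(1,2), of "m - 1 - j"] that p(3) by (simp add: u_def)
  qed simp
qed

text \<open>Hence 0 is a root of the obstruction for finitely many parameters \<open>t\<close> only.
  The factor \<open>d\<close> allows for twists.\<close>

lemma eigen_coef_poly_parameter:
  assumes "(d :: 'a) \<noteq> 0" "(2 :: 'a) \<noteq> 0"
  shows "\<exists>P. degree P = m \<and> P \<noteq> 0 \<and> (\<forall>t. poly P t = eigen_coef (d * t) B m 0 m)"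
proof -
  define u where "u j = (- (2 * d * of_nat ((m - j) ^ 2)) / lead_coef (m - 1 - j) :: 'a)" for j
  define w where "w j = (- (B * of_nat ((m - j) * (2 * (m - j) - 1))) / lead_coef (m - 2 - j) :: 'a)" for j
  show ?thesis
  proof (rule three_term_recurrence_poly[of "\<lambda>t. eigen_coef (d * t) B m 0" u "\<lambda>_. 0" w m])
    show "eigen_coef (d * t) B m 0 (Suc 0) = u 0 * t + 0" for t
      by (simp add: u_def mult_ac)
    show "eigen_coef (d * t) B m 0 (Suc (Suc j))
      = (u (Suc j) * t + 0) * eigen_coef (d * t) B m 0 (Suc j) + w j * eigen_coef (d * t) B m 0 j" for t j
    proof -
      have "m - 1 - Suc j = m - 2 - j" "m - Suc j = m - 1 - j"
        by simp_all
      then have u: "u (Suc j) * t + 0 = (0 - 2 * (d * t) * of_nat ((m - 1 - j) ^ 2)) / lead_coef (m - 2 - j)"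
        by (simp add: u_def mult_ac)
      have *: "(x * e - y * f) / l = x / l * e + (- y) / l * f" for x y e f l :: 'a
        by (simp add: diff_divide_distrib)
      then show ?thesis
        by (simp only: eigen_coef.simps w_def u *)
    qed
    show "u j \<noteq> 0" if "j < m" for j
    proof -
      have "of_nat (m - j) \<noteq> (0 :: 'a)"
        using that p by (intro of_nat_less_CHAR_nonzero[of p]) auto
      then show ?thesis
        using lead_coef_nonzero[OF p(1,2), of "m - 1 - j"] that p(3) assms by (simp add: u_def)
    qed
  qed simp
qed

text \<open>The recurrence indexed by exponents; the \<open>if\<close> expresses that coefficients
  beyond \<open>m\<close> are 0.\<close>

lemma eigen_coef_rec:
  assumes "k < m"
  shows "lead_coef k * eigen_coef A B m \<nu> (m - k) = (\<nu> - 2 * A * of_nat ((k + 1) ^ 2)) * eigen_coef A B m \<nu> (m - (k + 1))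
    - B * of_nat ((k + 2) * (2 * k + 3)) * (if k + 2 \<le> m then eigen_coef (A :: 'a) B m \<nu> (m - (k + 2)) else 0)"
proof -
  have "lead_coef k \<noteq> (0 :: 'a)"
    using lead_coef_nonzero[OF p(1,2), of k] assms p(3) by simp
  then have cancel: "lead_coef k * (z / lead_coef k) = (z :: 'a)" for z
    by simp
  obtain j where j: "m = Suc (k + j)"
    using assms less_imp_Suc_add by blast
  show ?thesis
  proof (cases j)
    case 0
    then have m: "m = Suc k" "m - k = Suc 0" "m - (k + 1) = 0" "m - 1 = k" "k + 1 = Suc k"
      using j by simp_all
    show ?thesis
      unfolding m(2,3) eigen_coef.simps m(4) cancel by (simp add: m(1))
  next
    case (Suc i)
    then have m: "m - k = Suc (Suc i)" "m - (k + 1) = Suc i" "m - (k + 2) = i"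
      "m - 1 - i = k + 1" "m - i = k + 2" "m - 2 - i = k" "2 * (k + 2) - 1 = 2 * k + 3" "k + 2 \<le> m"
      using j by simp_all
    show ?thesis
      unfolding m(1-3) eigen_coef.simps m(4-7) cancel using m(8) by simp
  qed
qed

end

section \<open>Norms with zero derivative and zeros of eigenpolynomials\<close>

lemma pderiv_linear_power_mult:
  "pderiv ([:-x, 1:] ^ Suc n * q) = [:-x, 1:] ^ n * (smult (of_nat (Suc n)) q + [:-x, 1:] * pderiv q)"
  for q :: "'a::idom poly"
  unfolding pderiv_mult pderiv_power_Suc by (simp add: pderiv_pCons algebra_simps del: of_nat_Suc)

text \<open>Only the terms of degree 0 and \<open>p\<close> survive, and together they form a
  \<open>p\<close>-th power by additivity of Frobenius.\<close>

lemma pderiv_eq_0_imp_linear_power: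
  fixes q :: "'a::alg_closed_field poly"
  assumes p: "prime p" "CHAR('a) = p" and "degree q = p" "pderiv q = 0"
  obtains x where "q = smult (lead_coeff q) ([:-x, 1:] ^ p)"
proof -
  have p0: "0 < p"
    using p(1) by (rule prime_gt_0_nat)
  have lc: "lead_coeff q \<noteq> 0"
    using assms(3) p0 by auto
  have mid: "coeff q n = 0" if "n \<noteq> 0" "n \<noteq> p" for n
  proof (cases "n < p")
    case True
    have "of_nat n * coeff q n = 0"
      using arg_cong[OF assms(4), of "\<lambda>r. coeff r (n - 1)"] that by (simp add: coeff_pderiv)
    moreover have "of_nat n \<noteq> (0 :: 'a)"
      using that True p by (intro of_nat_less_CHAR_nonzero) auto
    ultimately show ?thesis
      by simp
  qed (use that assms(3) in \<open>auto intro!: coeff_eq_0\<close>)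
  obtain w where w: "w ^ p = coeff q 0 / lead_coeff q"
    using nth_root_exists[OF p0] by metis
  have "[:w, 1:] ^ p = ([:w:] + [:0, 1:]) ^ p"
    by simp
  also have "\<dots> = [:w ^ p:] + [:0, 1:] ^ p"
    using p by (subst freshmans_dream) (auto simp: poly_const_pow)
  also have "[:0, 1:] ^ p = monom (1 :: 'a) p"
    by (simp add: monom_altdef)
  finally have "smult (lead_coeff q) ([:w, 1:] ^ p) = [:coeff q 0:] + monom (lead_coeff q) p"
    using lc by (simp add: smult_add_right smult_monom w)
  also have "\<dots> = q"
    using mid assms(3) p0 by (intro poly_eqI) (auto simp: coeff_pCons split: nat.splits)
  finally show ?thesis
    using that[of "-w"] by simp
qed

text \<open>At a zero of order \<open>r \<ge> 2\<close> compare lowest terms: if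
  \<open>F(x) \<noteq> 0\<close>, then \<open>2 F a''\<close> has order \<open>r - 2\<close> and
  nothing cancels it; at a simple root of \<open>F\<close> the term of order \<open>r - 1\<close>
  carries the factor \<open>r (2 r - 1)\<close>, nonzero as \<open>2 r < p\<close>.\<close>

lemma (in cubic) eigenvector_primitive:
  assumes "prime p" "CHAR('a) = p" "2 * degree a < p" "a \<noteq> 0"
    and ode: "2 * F * pderiv (pderiv a) + pderiv F * pderiv a = smult \<nu> a"
  shows "poly a x \<noteq> 0 \<or> poly (pderiv a) x \<noteq> 0"
proof (rule ccontr)
  assume "\<not> ?thesis"
  then have 0: "poly a x = 0" "poly (pderiv a) x = 0"
    by auto
  define t where "t = [:-x, 1:]"
  have tx: "poly t x = 0" "t \<noteq> 0"
    by (simp_all add: t_def)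
  obtain c where c: "a = t ^ order x a * c" "\<not> t dvd c"
    using order_decomp[OF assms(4), of x] by (auto simp: t_def)
  then have cx: "poly c x \<noteq> 0"
    by (simp add: t_def poly_eq_0_iff_dvd)
  have "order x a \<le> degree a"
    by (rule order_degree[OF assms(4)])
  then have small: "2 * order x a < p"
    using assms(3) by linarith
  then have nz: "of_nat k \<noteq> (0 :: 'a)" if "0 < k" "k < 2 * order x a" for k
    using that assms by (intro of_nat_less_CHAR_nonzero[of p]) auto
  have "order x a \<noteq> 0"
    using 0(1) assms(4) by (simp add: order_root)
  moreover have "order x a \<noteq> 1"
  proof
    assume "order x a = 1"
    then have "a = t ^ Suc 0 * c"
      using c by simp
    then have "pderiv a = t ^ 0 * (smult (of_nat (Suc 0)) c + t * pderiv c)"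
      unfolding t_def by (simp only: pderiv_linear_power_mult)
    then show False
      using 0 cx tx by simp
  qed
  ultimately obtain e where e: "order x a = Suc (Suc e)"
    by (metis One_nat_def not0_implies_Suc)
  have a: "a = t ^ Suc (Suc e) * c"
    using c e by simp
  define b where "b = smult (of_nat (Suc (Suc e))) c + t * pderiv c"
  have a': "pderiv a = t ^ Suc e * b"
    unfolding a b_def t_def by (rule pderiv_linear_power_mult)
  define g where "g = smult (of_nat (Suc e)) b + t * pderiv b"
  have a'': "pderiv (pderiv a) = t ^ e * g"
    unfolding a' g_def t_def by (rule pderiv_linear_power_mult)
  have bx: "poly b x \<noteq> 0"
    using nz[of "Suc (Suc e)"] e cx by (simp add: b_def tx del: of_nat_Suc)
  have gx: "poly g x = of_nat (Suc e) * poly b x"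
    by (simp add: g_def tx)
  have gx0: "poly g x \<noteq> 0"
    using nz[of "Suc e"] e bx by (simp add: gx del: of_nat_Suc)
  have "t ^ e * (2 * F * g + pderiv F * t * b) = smult \<nu> a"
    using ode unfolding a'' unfolding a' by (simp add: algebra_simps)
  also have "\<dots> = t ^ e * smult \<nu> (t * t * c)"
    by (subst a) (simp add: mult_ac)
  finally have "t ^ e * (2 * F * g + pderiv F * t * b) = t ^ e * smult \<nu> (t * t * c)" .
  then have *: "2 * F * g + pderiv F * t * b = smult \<nu> (t * t * c)"
    using tx(2) by (metis mult_cancel_left power_not_zero)
  have "2 * (poly F x * poly g x) = 0"
    using arg_cong[OF *, of "\<lambda>q. poly q x"] by (simp add: tx del: F_simps)
  then have "poly F x = 0"
    using gx0 two_nonzero by (simp del: F_simps)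
  then obtain h where h: "F = t * h"
    unfolding poly_eq_0_iff_dvd t_def by blast
  have hx: "poly h x \<noteq> 0"
  proof
    assume "poly h x = 0"
    then have "t ^ 2 dvd F"
      unfolding h poly_eq_0_iff_dvd t_def power2_eq_square by (intro mult_dvd_mono dvd_refl)
    then show False
      unfolding t_def using linear_sq_not_dvd_F by blast
  qed
  have "t * (2 * h * g + pderiv F * b) = t * smult \<nu> (t * c)"
    using * unfolding h by (simp add: algebra_simps)
  then have **: "2 * h * g + pderiv F * b = smult \<nu> (t * c)"
    using tx(2) by (metis mult_cancel_left)
  have "poly (pderiv F) x = poly h x"
    unfolding h by (simp add: pderiv_mult tx) (simp add: t_def pderiv_pCons)
  then have "poly h x * (2 * poly g x + poly b x) = 0"
    using arg_cong[OF **, of "\<lambda>q. poly q x"] by (simp add: tx algebra_simps)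
  then have "poly h x * (of_nat (2 * Suc e + 1) * poly b x) = 0"
    by (simp add: gx algebra_simps)
  moreover have "of_nat (2 * Suc e + 1) \<noteq> (0 :: 'a)"
    using e by (intro nz) auto
  ultimately show False
    using bx hx by (simp del: of_nat_add of_nat_mult of_nat_Suc)
qed

locale cubic_alg_closed = cubic A B C for A B C :: "'a::alg_closed_field"
begin

text \<open>Converse of \<open>torsion_imp_eigenvector\<close>: with \<open>b = a' / l\<close> the
  norm of \<open>a + b y\<close> has derivative 0 and degree \<open>p\<close>, so it is a constant
  times a \<open>p\<close>-th power of a linear factor.\<close>

lemma eigenvector_imp_torsion:
  assumes p: "prime p" "CHAR('a) = p" "p = 2 * m + 1"
    and a: "degree a = m" "m > 0"
    and ode: "2 * F * pderiv (pderiv a) + pderiv F * pderiv a = smult \<nu> a" and "\<nu> \<noteq> 0"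
  shows "torsion E p \<noteq> {Infinity}"
proof -
  obtain l where "l ^ 2 = \<nu> / 2"
    using nth_root_exists[of 2] by (metis zero_less_numeral)
  then have "2 * l ^ 2 = 2 * (\<nu> / 2)"
    by (simp only:)
  also have "\<dots> = \<nu>"
    using two_nonzero by (simp add: mult.commute[of 2])
  finally have l: "\<nu> = 2 * l ^ 2" ..
  then have l0: "l \<noteq> 0"
    using \<open>\<nu> \<noteq> 0\<close> by auto
  define b where "b = smult (1 / l) (pderiv a)"
  have a': "pderiv a = smult l b"
    using l0 by (simp add: b_def)
  have "2 * F * pderiv b + pderiv F * b = smult (1 / l) (2 * F * pderiv (pderiv a) + pderiv F * pderiv a)"
    by (simp add: b_def pderiv_smult smult_add_right)
  also have "\<dots> = smult (2 * l) a"
    unfolding ode l using l0 by (simp add: power2_eq_square)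
  finally have b': "2 * F * pderiv b + pderiv F * b = smult (2 * l) a" .
  define N where "N = a ^ 2 - F * b ^ 2"
  have "pderiv N = 2 * a * pderiv a - b * (2 * F * pderiv b + pderiv F * b)"
    by (simp add: N_def pderiv_diff pderiv_mult power2_eq_square algebra_simps)
  also have "\<dots> = 0"
    unfolding a' b' by (simp add: numeral_poly mult_ac)
  finally have N': "pderiv N = 0" .
  have "of_nat m \<noteq> (0 :: 'a)"
    using p a by (intro of_nat_less_CHAR_nonzero[of p]) auto
  \<comment> \<open>So \<open>b\<close> has degree exactly \<open>m - 1\<close>, and the norm has
    degree \<open>2 (m - 1) + 3 = p\<close>.\<close>
  then have "coeff b (m - 1) \<noteq> 0"
    using a l0 by (auto simp: b_def coeff_pderiv)
  then have "b \<noteq> 0" "m - 1 \<le> degree b"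
    by (auto intro: le_degree)
  moreover have "degree b \<le> m - 1"
    using degree_pderiv_le_pred[of a] a l0 by (simp add: b_def)
  ultimately have "degree N = p"
    unfolding N_def degree_norm using a p(3) by simp
  then obtain x where "N = smult (lead_coeff N) ([:-x, 1:] ^ p)"
    using pderiv_eq_0_imp_linear_power[OF p(1,2) _ N'] by blast
  moreover have "lead_coeff N \<noteq> 0"
    using \<open>degree N = p\<close> p(3) by (metis add_is_0 degree_0 leading_coeff_0_iff zero_neq_one)
  moreover have "a \<noteq> 0"
    using a by auto
  then have "poly a x \<noteq> 0 \<or> poly b x \<noteq> 0"
    using eigenvector_primitive[OF p(1,2) _ _ ode, of x] a p(3) a' by auto
  ultimately obtain y where "on_curve E (Affine x y)" "gens (Affine x y) ^ p \<approx> 1"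
    using norm_power_imp_principal[of a b "lead_coeff N" x p] p(3) a(2) unfolding N_def by auto
  then have "Affine x y \<in> torsion E p"
    using point_mult_eq_Infinity_iff unfolding torsion_def by blast
  then show ?thesis
    by auto
qed

lemma eigenvector_exists:
  assumes p: "prime p" "CHAR('a) = p" "p = 2 * m + 1" and "m \<ge> 2" "C = 0"
    and "eigen_coef A B m 0 m \<noteq> 0"
  shows "\<exists>a \<nu>. degree a = m \<and> \<nu> \<noteq> 0 \<and>
    2 * F * pderiv (pderiv a) + pderiv F * pderiv a = smult \<nu> a"
proof -
  obtain P where P: "degree P = m" "\<And>\<nu>. poly P \<nu> = eigen_coef A B m \<nu> m"
    using eigen_coef_poly_eigenvalue[OF p, of A B] by blast
  then obtain \<nu> where "poly P \<nu> = 0"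
    using alg_closed_imp_poly_has_root[of P] assms(4) by auto
  then have \<nu>: "eigen_coef A B m \<nu> m = 0" and "\<nu> \<noteq> 0"
    using P assms(6) by auto
  \<comment> \<open>The constant coefficient is dictated by comparison at \<open>x ^ 0\<close>,
    namely \<open>B g 1 = \<nu> g 0\<close>; this is where \<open>\<nu> \<noteq> 0\<close>
    enters.\<close>
  define g where "g k = (if k = 0 then B * eigen_coef A B m \<nu> (m - 1) / \<nu>
    else if k \<le> m then eigen_coef A B m \<nu> (m - k) else 0)" for k
  define a where "a = (\<Sum>k\<le>m. monom (g k) k)"
  have ca: "coeff a n = g n" for n
    unfolding a_def coeff_sum using assms(4) by (auto simp: g_def)
  have "degree a = m"
  proof (rule antisym)
    show "degree a \<le> m"
      using assms(4) by (intro degree_le) (auto simp: ca g_def)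
    show "m \<le> degree a"
      using assms(4) by (intro le_degree) (auto simp: ca g_def)
  qed
  moreover have "2 * F * pderiv (pderiv a) + pderiv F * pderiv a = smult \<nu> a"
  proof (rule poly_eqI)
    fix n
    have F0: "F = [:0, B, A, 1:]"
      unfolding F_def using assms(5) by simp
    have F2: "2 * F = [:0, 2 * B, 2 * A, 2:]" and F': "pderiv F = [:B, 2 * A, 3:]"
      unfolding F0 by (simp_all add: numeral_poly pderiv_pCons)
    let ?L = "2 * F * pderiv (pderiv a) + pderiv F * pderiv a"
    have L0: "coeff ?L 0 = B * g 1"
      unfolding F2 F' by (simp add: coeff_pderiv ca)
    have L: "coeff ?L (Suc k) = of_nat (k * (2 * k + 1)) * g k + 2 * A * of_nat ((k + 1) ^ 2) * g (k + 1)
       + B * of_nat ((k + 2) * (2 * k + 3)) * g (k + 2)" for k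
      unfolding F2 F' by (cases k; cases "k - 1")
        (simp_all add: coeff_pderiv ca coeff_pCons algebra_simps power2_eq_square)
    show "coeff ?L n = coeff (smult \<nu> a) n"
    proof (cases n)
      case 0
      then show ?thesis
        using \<open>\<nu> \<noteq> 0\<close> assms(4) unfolding 0 L0 by (simp add: ca g_def)
    next
      case (Suc k)
      consider "k > m" | "k = m" | "0 < k" "k < m" | "k = 0"
        by linarith
      then show ?thesis
      proof cases
        case 1
        then show ?thesis
          unfolding Suc L by (simp add: ca g_def)
      next
        case 2
        \<comment> \<open>The topmost equation holds because \<open>2 m + 1 = p\<close> is 0 in the
          field.\<close>
        have "of_nat (m * (2 * m + 1)) = (0 :: 'a)"
          unfolding of_nat_eq_0_iff_char_dvd p(2) unfolding p(3) by (rule dvd_triv_right)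
        then show ?thesis
          unfolding Suc L 2 by (simp add: ca g_def)
      next
        case 3
        then have "g (k + 1) = eigen_coef A B m \<nu> (m - (k + 1))"
          "g (k + 2) = (if k + 2 \<le> m then eigen_coef A B m \<nu> (m - (k + 2)) else 0)"
          "of_nat (k * (2 * k + 1)) * g k = lead_coef k * eigen_coef A B m \<nu> (m - k)"
          by (simp_all add: g_def lead_coef_def)
        then show ?thesis
          unfolding Suc L eigen_coef_rec[OF p \<open>k < m\<close>] by (simp add: ca algebra_simps)
      next
        case 4
        have "g 1 = eigen_coef A B m \<nu> (m - (0 + 1))" "g 2 = eigen_coef A B m \<nu> (m - (0 + 2))"
          using assms(4) by (simp_all add: g_def numeral_2_eq_2)
        \<comment> \<open>The equation at \<open>x ^ 1\<close> is exactly the vanishing of the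
          obstruction.\<close>
        moreover have "(\<nu> - 2 * A * of_nat ((0 + 1) ^ 2)) * eigen_coef A B m \<nu> (m - (0 + 1))
            - B * of_nat ((0 + 2) * (2 * 0 + 3)) * eigen_coef A B m \<nu> (m - (0 + 2)) = 0"
          using eigen_coef_rec[OF p, of 0 A B \<nu>] \<nu> assms(4) by simp
        ultimately have "(\<nu> - 2 * A * of_nat ((0 + 1) ^ 2)) * g 1 - B * of_nat ((0 + 2) * (2 * 0 + 3)) * g 2 = 0"
          by (simp only:)
        then show ?thesis
          unfolding Suc 4 L by (simp add: ca algebra_simps flip: numeral_2_eq_2)
      qed
    qed
  qed
  ultimately show ?thesis
    using \<open>\<nu> \<noteq> 0\<close> by blast
qed

end

section \<open>The family of curves\<close>

lemma cubicI:
  fixes A B :: "'a::field"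
  assumes "(2 :: 'a) \<noteq> 0" "B \<noteq> 0" "A ^ 2 \<noteq> 4 * B"
  shows "cubic A B 0"
proof
  define F where "F = [:0, B, A, 1:]"
  have F': "pderiv F = [:B, 2 * A, 3:]"
    by (simp add: F_def pderiv_pCons)
  define r where "r = B ^ 2 * (A ^ 2 - 4 * B)"
  define D where "D = [:A ^ 2 - 4 * B:]"
  define q where "q = [:B, A, 1:]"
  define q' where "q' = [:A, 2:]"
  define x :: "'a poly" where "x = [:0, 1:]"
  define s where "s = [:A, 1:]"
  \<comment> \<open>With \<open>F = x q\<close>, both \<open>q\<^sup>2 = q F' - q' F\<close> and \<open>x\<^sup>2 q' = x F' - F\<close> lie in the ideal \<open>(F, F')\<close>,
    and \<open>disc q = q'\<^sup>2 - 4 q\<close>, \<open>B = q - x (x + A)\<close>.\<close>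
  have "(D * (- q' - 2 * s) + s ^ 2 * (- q' - 4 * x)) * F + (D * q + s ^ 2 * q' * x) * pderiv F = [:r:]"
    unfolding F' unfolding F_def D_def q_def q'_def x_def s_def r_def
    by (simp add: numeral_poly algebra_simps power2_eq_square)
  then have "smult (1 / r) ((D * (- q' - 2 * s) + s ^ 2 * (- q' - 4 * x)) * F
      + (D * q + s ^ 2 * q' * x) * pderiv F) = 1"
    using assms by (simp add: r_def one_pCons)
  then have "smult (1 / r) (D * (- q' - 2 * s) + s ^ 2 * (- q' - 4 * x)) * F
      + smult (1 / r) (D * q + s ^ 2 * q' * x) * pderiv F = 1"
    by (simp only: smult_add_right[of _ "_ * F"] mult_smult_left)
  then show "\<exists>u v. u * [:0, B, A, 1:] + v * pderiv [:0, B, A, 1:] = 1"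
    unfolding F_def by blast
qed fact

lemma to_ac_eigen_coef:
  "eigen_coef (to_ac A) (to_ac B) m (to_ac \<nu>) j = to_ac (eigen_coef A B m \<nu> j)"
proof -
  have "lead_coef k = to_ac (lead_coef k :: 'a)" for k
    by (simp add: lead_coef_def)
  then show ?thesis
    by (induction A B m \<nu> j rule: eigen_coef.induct) simp_all
qed

lemma ordinaryI:
  fixes A B :: "'a::field"
  assumes p: "prime p" "CHAR('a) = p" "p = 2 * m + 1" "m \<ge> 2"
    and "B \<noteq> 0" "A ^ 2 \<noteq> 4 * B" "eigen_coef A B m 0 m \<noteq> 0"
  shows "ordinary (Weierstrass 0 A 0 B 0)"
proof -
  have two: "of_nat 2 \<noteq> (0 :: 'a alg_closure)"
    using p by (intro of_nat_less_CHAR_nonzero[of p]) auto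
  have "to_ac (A ^ 2) \<noteq> to_ac (4 * B)"
    using assms(6) unfolding to_ac_eq_iff .
  then interpret cubic_alg_closed "to_ac A" "to_ac B" 0
    unfolding cubic_alg_closed_def using two assms(5) by (intro cubicI) auto
  have "eigen_coef (to_ac A) (to_ac B) m 0 m = to_ac (eigen_coef A B m 0 m)"
    using to_ac_eigen_coef[of A B m 0] by simp
  then have "eigen_coef (to_ac A) (to_ac B) m 0 m \<noteq> 0"
    using assms(7) by simp
  then obtain a \<nu> where "degree a = m" "\<nu> \<noteq> 0"
    "2 * F * pderiv (pderiv a) + pderiv F * pderiv a = smult \<nu> a"
    using eigenvector_exists[OF p(1) _ p(3,4) refl] p(2) by auto
  then have "torsion (Weierstrass 0 (to_ac A) 0 (to_ac B) 0) p \<noteq> {Infinity}"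
    using eigenvector_imp_torsion[OF p(1) _ p(3), of a \<nu>] p(2,4) by auto
  then show ?thesis
    by (simp add: ordinary_def p(2))
qed

section \<open>Squares in the prime field and quadratic twists\<close>

lemma of_nat_power_CHAR:
  assumes "prime p" "CHAR('a::comm_ring_1) = p"
  shows "(of_nat i :: 'a) ^ p = of_nat i"
proof (induction i)
  case 0
  then show ?case
    using prime_gt_0_nat[OF assms(1)] by (simp add: power_0_left)
next
  case (Suc i)
  have "(of_nat i + 1 :: 'a) ^ p = of_nat i ^ p + 1 ^ p"
    by (rule freshmans_dream) (use assms in simp_all)
  then show ?case
    by (simp only: Suc.IH of_nat_Suc power_one add.commute[of 1])
qed

text \<open>Euler's criterion by counting: the squares of \<open>1, ..., m\<close> are
  \<open>m\<close> distinct roots of \<open>X ^ m - 1\<close>, so there are no others.\<close>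

lemma root_of_unity_square:
  fixes z :: "'a::field"
  assumes p: "prime p" "CHAR('a) = p" "p = 2 * m + 1" and "m > 0" "z ^ m = 1"
  shows "\<exists>i. z = of_nat i ^ 2 \<and> of_nat i \<noteq> (0 :: 'a)"
proof (rule ccontr)
  assume neg: "\<not> ?thesis"
  let ?S = "(\<lambda>i. (of_nat i :: 'a) ^ 2) ` {1..m}"
  have nz: "of_nat k \<noteq> (0 :: 'a)" if "0 < k" "k < p" for k
    using that p(2) by (intro of_nat_less_CHAR_nonzero)
  have inj: "inj_on (\<lambda>i. (of_nat i :: 'a) ^ 2) {1..m}"
  proof (rule linorder_inj_onI')
    fix i j assume ij: "i \<in> {1..m}" "j \<in> {1..m}" "i < j"
    have "(of_nat j :: 'a) ^ 2 - of_nat i ^ 2 = of_nat (j - i) * of_nat (j + i)"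
      using ij by (simp add: of_nat_diff power2_eq_square algebra_simps)
    moreover have "of_nat (j - i) \<noteq> (0 :: 'a)" "of_nat (j + i) \<noteq> (0 :: 'a)"
      using ij p(3) by (intro nz; simp)+
    ultimately show "(of_nat i :: 'a) ^ 2 \<noteq> of_nat j ^ 2"
      by auto
  qed
  have root: "(of_nat i ^ 2) ^ m = (1 :: 'a)" if "i \<in> {1..m}" for i
  proof -
    have "of_nat i * (of_nat i ^ 2) ^ m = (of_nat i :: 'a) ^ p"
      unfolding p(3) by (simp add: power_add flip: power_mult)
    also have "\<dots> = of_nat i * 1"
      using of_nat_power_CHAR[OF p(1,2), of i] by simp
    finally show ?thesis
      using nz[of i] that p(3) by simp
  qed
  define P where "P = monom 1 m - (1 :: 'a poly)"
  have "coeff P m = 1"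
    using assms(4) by (simp add: P_def)
  then have "P \<noteq> 0"
    by auto
  have "degree P \<le> m"
    unfolding P_def by (intro degree_diff_le) (auto simp: degree_monom_le)
  have "z \<notin> ?S"
    using neg nz p(3) by auto
  then have "card (insert z ?S) = Suc m"
    using card_image[OF inj] by simp
  moreover have "insert z ?S \<subseteq> {x. poly P x = 0}"
    using root assms(5) by (auto simp: P_def poly_monom)
  then have "card (insert z ?S) \<le> card {x. poly P x = 0}"
    by (intro card_mono poly_roots_finite \<open>P \<noteq> 0\<close>)
  ultimately show False
    using card_poly_roots_bound[OF \<open>P \<noteq> 0\<close>] \<open>degree P \<le> m\<close> by simp
qed

lemma Infinity_in_torsion: "Infinity \<in> torsion E n"
proof -
  have "point_mult E n Infinity = Infinity"
    by (induction n) auto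
  then show ?thesis
    by (simp add: torsion_def)
qed

text \<open>Substituting \<open>d x\<close> for \<open>x\<close> turns the twisted cubic into
  \<open>d ^ 3 F\<close>, while each derivative contributes one factor \<open>d\<close>.\<close>

lemma twist_eigenvector:
  fixes d :: "'a::field"
  assumes "cubic A B C" "cubic (d * A) (d ^ 2 * B) (d ^ 3 * C)" "d \<noteq> 0"
    and ode: "2 * cubic.F (d * A) (d ^ 2 * B) (d ^ 3 * C) * pderiv (pderiv a)
      + pderiv (cubic.F (d * A) (d ^ 2 * B) (d ^ 3 * C)) * pderiv a = smult \<nu> a"
    and "pderiv a \<noteq> 0"
  defines "b \<equiv> pcompose a [:0, d:]"
  shows "2 * cubic.F A B C * pderiv (pderiv b) + pderiv (cubic.F A B C) * pderiv b = smult (\<nu> / d) b"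
    and "pderiv b \<noteq> 0"
proof -
  interpret c1: cubic A B C by fact
  interpret c2: cubic "d * A" "d ^ 2 * B" "d ^ 3 * C" by fact
  define L :: "'a poly" where "L = [:0, d:]"
  have FL: "pcompose c2.F L = smult (d ^ 3) c1.F"
    unfolding c1.F_def c2.F_def L_def
    by (simp add: pcompose_pCons power2_eq_square power3_eq_cube mult_ac)
  have deriv: "pderiv (pcompose q L) = smult d (pcompose (pderiv q) L)" for q
    by (simp add: pderiv_pcompose L_def pderiv_pCons)
  have F'L: "smult d (pcompose (pderiv c2.F) L) = smult (d ^ 3) (pderiv c1.F)"
    unfolding deriv[symmetric] FL pderiv_smult ..
  have b': "pderiv b = smult d (pcompose (pderiv a) L)"
    unfolding b_def L_def[symmetric] by (rule deriv)
  have b'': "pderiv (pderiv b) = smult (d ^ 2) (pcompose (pderiv (pderiv a)) L)"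
    unfolding b' pderiv_smult deriv by (simp add: power2_eq_square)
  have "smult (d ^ 3) (2 * c1.F * pderiv (pderiv b) + pderiv c1.F * pderiv b)
     = 2 * smult (d ^ 3) c1.F * pderiv (pderiv b) + smult (d ^ 3) (pderiv c1.F) * pderiv b"
    by (simp add: smult_add_right)
  also have "\<dots> = smult (d ^ 2) (pcompose (2 * c2.F * pderiv (pderiv a) + pderiv c2.F * pderiv a) L)"
    unfolding FL[symmetric] F'L[symmetric] b'' unfolding b'
    by (simp add: pcompose_add pcompose_mult pcompose_smult smult_add_right power2_eq_square numeral_poly)
  also have "\<dots> = smult (d ^ 3) (smult (\<nu> / d) b)"
    unfolding ode using assms(3)
    by (simp add: pcompose_smult b_def L_def power2_eq_square power3_eq_cube mult_ac)
  finally have "smult (d ^ 3) (2 * c1.F * pderiv (pderiv b) + pderiv c1.F * pderiv b - smult (\<nu> / d) b) = 0"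
    unfolding smult_diff_right by (simp only: diff_self)
  then show "2 * c1.F * pderiv (pderiv b) + pderiv c1.F * pderiv b = smult (\<nu> / d) b"
    using assms(3) unfolding smult_eq_0_iff by auto
  have "pcompose (pderiv a) L \<noteq> 0"
    using assms(3,5) pcompose_eq_0[of "pderiv a" L] by (auto simp: L_def)
  then show "pderiv b \<noteq> 0"
    unfolding b' using assms(3) by simp
qed

lemma torsion_or_twist_trivial:
  fixes A B d :: "'a::field"
  assumes p: "prime p" "CHAR('a) = p" "p = 2 * m + 1" "m > 0"
    and "cubic A B C" "cubic (d * A) (d ^ 2 * B) (d ^ 3 * C)"
    and d: "\<And>e. d \<noteq> e ^ 2"
  shows "torsion (Weierstrass 0 A 0 B C) p = {Infinity} \<or>
    torsion (Weierstrass 0 (d * A) 0 (d ^ 2 * B) (d ^ 3 * C)) p = {Infinity}"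
proof (rule ccontr)
  interpret c1: cubic A B C by fact
  interpret c2: cubic "d * A" "d ^ 2 * B" "d ^ 3 * C" by fact
  assume neg: "\<not> ?thesis"
  have d0: "d \<noteq> 0"
    using d[of 0] by auto
  obtain P Q where P: "P \<noteq> Infinity" "P \<in> torsion c1.E p" and Q: "Q \<noteq> Infinity" "Q \<in> torsion c2.E p"
    using neg Infinity_in_torsion by blast
  have p': "odd p" "p > 0"
    using p(3) by auto
  obtain a k where a: "k \<noteq> 0" "pderiv a \<noteq> 0"
    "2 * c1.F * pderiv (pderiv a) + pderiv c1.F * pderiv a = smult (2 * k ^ 2) a"
    using c1.torsion_imp_eigenvector[OF p(2) p' P] by blast
  obtain b l where b: "l \<noteq> 0" "pderiv b \<noteq> 0"
    "2 * c2.F * pderiv (pderiv b) + pderiv c2.F * pderiv b = smult (2 * l ^ 2) b"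
    using c2.torsion_imp_eigenvector[OF p(2) p' Q] by blast
  \<comment> \<open>Both eigenpolynomials are brought to the same cubic; the eigenvalue of the twist
    is divided by \<open>d\<close>.\<close>
  note tw = twist_eigenvector[OF assms(5,6) d0 b(3,2)]
  have eq: "(2 * k ^ 2) ^ m = (2 * l ^ 2 / d) ^ m"
    by (rule c1.eigenvalue_unique[OF p(1-3) a(3,2) tw])
  have "(d * (k / l) ^ 2) ^ m = 1"
  proof -
    have "(d * (k / l) ^ 2) ^ m * (2 * l ^ 2 / d) ^ m = (2 * k ^ 2) ^ m"
      unfolding power_mult_distrib[symmetric] using b(1) d0 by (simp add: power_divide)
    then show ?thesis
      unfolding eq using b(1) d0 c1.two_nonzero by simp
  qed
  then obtain i where i: "d * (k / l) ^ 2 = of_nat i ^ 2"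
    using root_of_unity_square[OF p(1-4)] by blast
  have "d = (of_nat i * l / k) ^ 2"
    using i a(1) b(1) by (simp add: field_simps)
  then show False
    using d by blast
qed

section \<open>Invariants of the family\<close>

lemma discriminant_cubic: "discriminant (Weierstrass 0 A 0 B 0) = 16 * B ^ 2 * (A ^ 2 - 4 * B)"
  by (simp add: discriminant_def power2_eq_square power3_eq_cube algebra_simps)

lemma c4_cubic: "weierstrass_c4 (Weierstrass 0 A 0 B 0) = 16 * (A ^ 2 - 3 * B)"
  by (simp add: weierstrass_c4_def power2_eq_square algebra_simps)

lemma elliptic_curve_cubic:
  fixes A B :: "'a::field"
  assumes "(2 :: 'a) \<noteq> 0" "B \<noteq> 0" "A ^ 2 \<noteq> 4 * B"
  shows "elliptic_curve (Weierstrass 0 A 0 B 0)"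
proof -
  have "(16 :: 'a) = 2 ^ 4"
    by simp
  then have "(16 :: 'a) \<noteq> 0"
    using assms(1) by (metis power_not_zero)
  then show ?thesis
    using assms by (simp add: elliptic_curve_def discriminant_cubic)
qed

lemma j_invariant_twist:
  assumes "(d :: 'a::field) \<noteq> 0"
  shows "j_invariant (Weierstrass 0 (d * A) 0 (d ^ 2 * B) 0) = j_invariant (Weierstrass 0 A 0 B 0)"
proof -
  have c4: "16 * ((d * A) ^ 2 - 3 * (d ^ 2 * B)) = d ^ 2 * (16 * (A ^ 2 - 3 * B))"
    by (simp add: algebra_simps power2_eq_square)
  have disc: "16 * (d ^ 2 * B) ^ 2 * ((d * A) ^ 2 - 4 * (d ^ 2 * B)) = d ^ 6 * (16 * B ^ 2 * (A ^ 2 - 4 * B))"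
    by (simp add: algebra_simps power2_eq_square numeral_eq_Suc)
  have cube: "(d ^ 2 * x) ^ 3 = d ^ 6 * x ^ 3" for x
    by (simp add: power_mult_distrib flip: power_mult)
  show ?thesis
    unfolding j_invariant_def discriminant_cubic c4_cubic c4 disc cube
    using assms by (intro mult_divide_mult_cancel_left) simp
qed

text \<open>Clearing denominators turns the condition on \<open>t\<close> into a polynomial equation
  of degree 6.\<close>

lemma finite_j_invariant_fibre:
  fixes v :: "'a::field"
  assumes "(2 :: 'a) \<noteq> 0"
  shows "finite {t. t ^ 2 \<noteq> 4 \<and> j_invariant (Weierstrass 0 t 0 1 0) = v}"
proof -
  define c :: 'a where "c = 16 ^ 3"
  define P where "P = smult c ([:-3, 0, 1:] ^ 3) - smult (16 * v) [:-4, 0, 1:]"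
  have two: "(2 :: 'a) ^ k \<noteq> 0" for k
    using assms by simp
  have "(16 :: 'a) = 2 ^ 4"
    by simp
  then have s: "(16 :: 'a) \<noteq> 0"
    using two by metis
  then have "c \<noteq> 0"
    unfolding c_def by (rule power_not_zero)
  then have "degree (smult c ([:-3, 0, 1:] ^ 3)) = 6"
    by (simp add: degree_power_eq)
  moreover have "degree (smult (16 * v) [:-4, 0, 1:]) \<le> 2"
    by (intro order.trans[OF degree_smult_le]) simp
  ultimately have "degree P = 6"
    unfolding P_def diff_conv_add_uminus by (subst degree_add_eq_left) simp_all
  then have "P \<noteq> 0"
    by auto
  moreover have "{t. t ^ 2 \<noteq> 4 \<and> j_invariant (Weierstrass 0 t 0 1 0) = v} \<subseteq> {t. poly P t = 0}"
  proof safe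
    fix t :: 'a assume t: "t ^ 2 \<noteq> 4" "v = j_invariant (Weierstrass 0 t 0 1 0)"
    have nz: "16 * (t ^ 2 - 4) \<noteq> 0"
      using t(1) s by (simp only: mult_eq_0_iff right_minus_eq) simp
    have "v * (16 * (t ^ 2 - 4)) = (16 * (t ^ 2 - 3)) ^ 3"
      unfolding t(2) j_invariant_def discriminant_cubic c4_cubic
      by (simp only: power_one mult_1_right times_divide_eq_left nonzero_mult_div_cancel_right[OF nz])
    then have "c * (t ^ 2 - 3) ^ 3 - v * (16 * (t ^ 2 - 4)) = 0"
      by (simp only: c_def power_mult_distrib diff_self)
    then show "poly P t = 0"
      by (simp add: P_def power2_eq_square algebra_simps)
  qed
  ultimately show ?thesis
    using poly_roots_finite finite_subset by blast
qed

section \<open>Nonsquares in a Hilbertian field\<close>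

lemma to_fract_not_square: "to_fract [:0, 1:] \<noteq> (r :: 'a::field poly fract) ^ 2"
proof
  assume *: "to_fract [:0, 1:] = r ^ 2"
  obtain a b where r: "r = Fract a b" "b \<noteq> 0"
    by (cases r) auto
  have "to_fract [:0, 1:] * to_fract b ^ 2 = to_fract a ^ 2"
    using r unfolding * by (simp add: Fract_conv_to_fract power_divide)
  then have "to_fract ([:0, 1:] * b ^ 2) = to_fract (a ^ 2)"
    by (simp only: power2_eq_square to_fract_mult)
  then have "degree ([:0, 1:] * b ^ 2) = degree (a ^ 2)" "a \<noteq> 0"
    using r(2) unfolding to_fract_eq_iff by auto
  then have "1 + 2 * degree b = 2 * degree a"
    using r(2) by (simp add: degree_mult_eq degree_power_eq)
  then show False
    by presburger
qed

lemma irreducible_quadratic: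
  fixes c :: "'a::field"
  assumes "\<And>r. c \<noteq> r ^ 2"
  shows "irreducible [:-c, 0, 1:]"
proof (rule irreducibleI)
  fix u v assume uv: "[:-c, 0, 1:] = u * v"
  show "is_unit u \<or> is_unit v"
  proof (rule ccontr)
    assume neg: "\<not> ?thesis"
    have nz: "u \<noteq> 0" "v \<noteq> 0"
      using uv by auto
    then have "degree u + degree v = 2"
      using arg_cong[OF uv, of degree] by (simp add: degree_mult_eq)
    moreover have "degree u \<noteq> 0" "degree v \<noteq> 0"
      using neg nz by (auto simp: is_unit_iff_degree)
    ultimately have "degree u = 1"
      by linarith
    then obtain a b where u: "u = [:a, b:]" "b \<noteq> 0"
      by (cases u rule: pCons_cases) (metis One_nat_def degree_eq_zeroE degree_pCons_eq_if nat.inject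
        not0_implies_Suc pCons_eq_0_iff zero_neq_one)
    have "poly u (- a / b) = 0"
      using u by simp
    then have "poly [:-c, 0, 1:] (- a / b) = 0"
      unfolding uv by simp
    then have "c = (- a / b) ^ 2"
      by (simp add: power2_eq_square)
    then show False
      using assms by blast
  qed
qed (simp_all add: is_unit_iff_degree)

text \<open>The Hilbertian property is applied to \<open>X ^ 2 - T\<close>, which factors after
  specialization at any square.\<close>

lemma hilbertian_nonsquare:
  assumes "hilbertian TYPE('a::field)" "(2 :: 'a) \<noteq> 0"
  shows "infinite {d :: 'a. \<forall>e. d \<noteq> e ^ 2}"
proof -
  define f :: "'a poly poly" where "f = [:- [:0, 1:], 0, 1:]"
  have f: "map_poly to_fract f = [:- to_fract [:0, 1:], 0, 1:]"
    by (simp add: f_def map_poly_pCons del: minus_pCons)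
  have "irreducible (map_poly to_fract f)"
    unfolding f by (rule irreducible_quadratic) (rule to_fract_not_square)
  moreover have "coprime (map_poly to_fract f) (pderiv (map_poly to_fract f))"
  proof -
    have two: "(2 :: 'a poly fract) \<noteq> 0"
    proof -
      have "to_fract [:2 :: 'a:] = 2"
        by (metis numeral_poly one_add_one to_fract_1 to_fract_add)
      then show ?thesis
        using assms(2) by (metis pCons_eq_0_iff to_fract_eq_0_iff)
    qed
    have T: "to_fract [:0, 1 :: 'a:] \<noteq> 0"
      by simp
    show ?thesis
    proof (rule coprimeI)
      fix c assume c: "c dvd map_poly to_fract f" "c dvd pderiv (map_poly to_fract f)"
      \<comment> \<open>With \<open>f = X ^ 2 - T\<close>, the combination
        \<open>(X / 2) f' - f = T\<close> is a unit of \<open>K(T)[X]\<close>.\<close>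
      have "c dvd [:0, 1 / 2:] * pderiv (map_poly to_fract f) - map_poly to_fract f"
        using c by (intro dvd_diff dvd_mult)
      also have "\<dots> = [:to_fract [:0, 1:]:]"
        using two by (simp add: f pderiv_pCons)
      finally show "is_unit c"
        using T by (meson dvd_trans is_unit_pCons_iff is_unit_poly_iff dvd_field_iff is_unit_const_poly_iff)
    qed
  qed
  ultimately have "infinite {a. irreducible (specialize f a)}"
    using assms(1) unfolding hilbertian_def by blast
  moreover have "{a. irreducible (specialize f a)} \<subseteq> {d. \<forall>e. d \<noteq> e ^ 2}"
  proof safe
    fix e :: 'a assume "irreducible (specialize f (e ^ 2))"
    moreover have "specialize f (e ^ 2) = [:-e, 1:] * [:e, 1:]"
      by (simp add: specialize_def f_def map_poly_pCons power2_eq_square)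
    ultimately have "is_unit [:-e, 1:] \<or> is_unit [:e, 1:]"
      by (metis irreducibleD)
    then show False
      by (auto simp: is_unit_pCons_iff)
  qed
  ultimately show ?thesis
    using finite_subset by blast
qed

theorem corollary1p3:
  fixes p :: nat
  assumes "hilbertian TYPE('a::field)"
    and "CHAR('a) = p"
    and "p \<ge> 5"
  shows "\<exists>S :: 'a weierstrass set.
           infinite S \<and> inj_on j_invariant S \<and>
           (\<forall>E\<in>S. elliptic_curve E \<and> ordinary E \<and>
                  torsion E p = {Infinity} \<and> power_torsion E p = {Infinity})"
proof -
  have p: "prime p" "CHAR('a) = p"
    using prime_CHAR_semidom[where ?'a = 'a] assms by auto
  have "odd p"
    using p(1) assms(3) by (intro prime_odd_nat) auto
  then obtain m where m: "p = 2 * m + 1"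
    by (elim oddE)
  then have m2: "m \<ge> 2" "m > 0"
    using assms(3) by auto
  have "of_nat 2 \<noteq> (0 :: 'a)"
    using p assms(3) by (intro of_nat_less_CHAR_nonzero[of p]) auto
  then have two: "(2 :: 'a) \<noteq> 0"
    by simp
  have inf: "infinite {d :: 'a. \<forall>e. d \<noteq> e ^ 2}"
    using hilbertian_nonsquare assms(1) two .
  then obtain d :: 'a where d: "\<And>e. d \<noteq> e ^ 2"
    by (metis (mono_tags, lifting) finite.emptyI ex_in_conv mem_Collect_eq)
  have d0: "d \<noteq> 0"
    using d[of 0] by auto
  define good where "good E \<longleftrightarrow> elliptic_curve E \<and> ordinary E \<and>
    torsion E p = {Infinity} \<and> power_torsion E p = {Infinity}" for E :: "'a weierstrass"
  \<comment> \<open>For \<open>t\<close> in \<open>T\<close> both the curve and its twist by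
    \<open>d\<close> are nonsingular and ordinary.\<close>
  define T where "T = {t :: 'a. t ^ 2 \<noteq> 4 \<and> eigen_coef t 1 m 0 m \<noteq> 0 \<and> eigen_coef (d * t) (d ^ 2) m 0 m \<noteq> 0}"
  have goodT: "\<exists>E. good E \<and> j_invariant E = j_invariant (Weierstrass 0 t 0 1 0)" if "t \<in> T" for t
  proof -
    have t: "t ^ 2 \<noteq> 4 * 1" "eigen_coef t 1 m 0 m \<noteq> 0" "eigen_coef (d * t) (d ^ 2) m 0 m \<noteq> 0"
      using that by (auto simp: T_def)
    have td: "(d * t) ^ 2 \<noteq> 4 * d ^ 2"
      using t(1) d0 by (simp add: power_mult_distrib)
    interpret c1: cubic t 1 0
      using two t(1) by (intro cubicI) auto
    interpret c2: cubic "d * t" "d ^ 2" 0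
      using two td d0 by (intro cubicI) auto
    have "torsion c1.E p = {Infinity} \<or> torsion c2.E p = {Infinity}"
      using torsion_or_twist_trivial[OF p m m2(2), of t 1 0 d] c1.cubic_axioms c2.cubic_axioms d by simp
    moreover have "elliptic_curve c1.E" "ordinary c1.E"
      using elliptic_curve_cubic[OF two one_neq_zero t(1)]
        ordinaryI[OF p m m2(1) one_neq_zero t(1,2)] by auto
    moreover have "elliptic_curve c2.E" "ordinary c2.E"
      using elliptic_curve_cubic[OF two _ td] ordinaryI[OF p m m2(1) _ td] t d0 by auto
    ultimately have "good c1.E \<or> good c2.E"
      using c1.power_torsion_trivial c2.power_torsion_trivial unfolding good_def by blast
    moreover have "j_invariant c2.E = j_invariant c1.E"
      using j_invariant_twist[OF d0, of t 1] by simp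
    ultimately show ?thesis
      by metis
  qed
  have "infinite T"
  proof -
    obtain P :: "'a poly" where P: "P \<noteq> 0" "\<forall>t. poly P t = eigen_coef (1 * t) 1 m 0 m"
      using eigen_coef_poly_parameter[OF p m one_neq_zero two, of 1] by blast
    obtain Q :: "'a poly" where Q: "Q \<noteq> 0" "\<forall>t. poly Q t = eigen_coef (d * t) (d ^ 2) m 0 m"
      using eigen_coef_poly_parameter[OF p m d0 two, of "d ^ 2"] by blast
    have "- T \<subseteq> {t. poly [:-4, 0, 1:] t = 0} \<union> {t. poly P t = 0} \<union> {t. poly Q t = 0}"
    proof
      fix t assume "t \<in> - T"
      then have "poly [:-4, 0, 1:] t = 0 \<or> poly P t = 0 \<or> poly Q t = 0"
        unfolding P(2)[rule_format] Q(2)[rule_format] by (auto simp: T_def power2_eq_square)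
      then show "t \<in> {t. poly [:-4, 0, 1:] t = 0} \<union> {t. poly P t = 0} \<union> {t. poly Q t = 0}"
        by blast
    qed
    moreover have "finite \<dots>"
      using P(1) Q(1) by (intro finite_UnI poly_roots_finite) auto
    ultimately have "finite (- T)"
      by (rule finite_subset)
    \<comment> \<open>The field is infinite because it has infinitely many nonsquares.\<close>
    moreover have "infinite (UNIV :: 'a set)"
      using infinite_super[OF subset_UNIV inf] .
    ultimately show ?thesis
      by (metis Compl_partition finite_Un)
  qed
  \<comment> \<open>Infinitely many values of \<open>j\<close> occur, since the fibres are finite;
    picking one good curve for each value makes \<open>j\<close> injective.\<close>
  define J where "J = (\<lambda>t. j_invariant (Weierstrass 0 t 0 1 0)) ` T"
  have "infinite J"
  proof
    assume "finite J"
    then obtain v where "infinite {t \<in> T. j_invariant (Weierstrass 0 t 0 1 0) = v}"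
      using pigeonhole_infinite[OF \<open>infinite T\<close>] unfolding J_def by blast
    moreover have "{t \<in> T. j_invariant (Weierstrass 0 t 0 1 0) = v}
        \<subseteq> {t. t ^ 2 \<noteq> 4 \<and> j_invariant (Weierstrass 0 t 0 1 0) = v}"
      by (auto simp: T_def)
    ultimately show False
      using finite_j_invariant_fibre[OF two] finite_subset by blast
  qed
  have "\<forall>v\<in>J. \<exists>E. good E \<and> j_invariant E = v"
    using goodT unfolding J_def by blast
  then obtain pick where pick: "\<forall>v\<in>J. good (pick v) \<and> j_invariant (pick v) = v"
    by metis
  then have "inj_on pick J"
    by (metis inj_onI)
  then have "infinite (pick ` J)"
    using \<open>infinite J\<close> by (simp add: finite_image_iff)
  moreover have "inj_on j_invariant (pick ` J)"
    using pick by (auto intro!: inj_onI)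
  moreover have "\<forall>E\<in>pick ` J. good E"
    using pick by blast
  ultimately show ?thesis
    unfolding good_def by blast
qed

end
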